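(* Let $n,m\geq 1$. Let $G=\mathbb{F}_{m+1}\ast_{\mathbb{Z}}\mathbb{F}_{n+1}$ be an amalgamated free product of the free group $\mathbb{F}_{m+1}$ of rank $m+1$ and the free group $\mathbb{F}_{n+1}$ of rank $n+1$ over an infinite cyclic subgroup $\mathbb{Z}$, such that the image of the generator of $\mathbb{Z}$ is a cyclically reduced word (with respect to a free basis) in both free groups. Then every finite index subgroup of $G$ belongs to the class $\mathcal{A}$.
   Context: An action of a countable group $\Gamma$ on a set $X$ is amenable if there exists a sequence $(A_n)_{n\geq1}$ of finite non-empty subsets of $X$ such that for every $g\in\Gamma$, $\lim_{n\to\infty}|A_n\,\triangle\, g\cdot A_n|/|A_n|=0$ (such a sequence is called a Følner sequence for the action). A countable group is in the class $\mathcal{A}$ if it admits an amenable, faithful and transitive action on an infinite countable set. *)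

theory Defs
  imports Complex_Main "HOL-Library.Countable_Set" "HOL-Algebra.Group_Action"
begin

type_synonym 'g letter = "'g \<times> bool"   (* (x, False) = x, (x, True) = x^-1 *)

definition inv_letter :: "'g letter \<Rightarrow> 'g letter" where
  "inv_letter x = (fst x, \<not> snd x)"

definition inv_word :: "'g letter list \<Rightarrow> 'g letter list" where
  "inv_word w = rev (map inv_letter w)"

definition reduced_word :: "'g letter list \<Rightarrow> bool" where
  "reduced_word w = (\<forall>i. Suc i < length w \<longrightarrow> w ! Suc i \<noteq> inv_letter (w ! i))"

definition cyclically_reduced :: "'g letter list \<Rightarrow> bool" where
  "cyclically_reduced w = (reduced_word w \<and> (w \<noteq> [] \<longrightarrow> last w \<noteq> inv_letter (hd w)))"

inductive_set pres_step :: "'g set \<Rightarrow> 'g letter list set \<Rightarrow> ('g letter list \<times> 'g letter list) set"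
  for S R where
  cancel: "\<lbrakk>u \<in> lists (S \<times> UNIV); v \<in> lists (S \<times> UNIV); x \<in> S \<times> UNIV\<rbrakk>
           \<Longrightarrow> (u @ v, u @ [x, inv_letter x] @ v) \<in> pres_step S R"
| relator: "\<lbrakk>u \<in> lists (S \<times> UNIV); v \<in> lists (S \<times> UNIV); r \<in> R; r \<in> lists (S \<times> UNIV)\<rbrakk>
           \<Longrightarrow> (u @ v, u @ r @ v) \<in> pres_step S R"

definition pres_equiv :: "'g set \<Rightarrow> 'g letter list set \<Rightarrow> ('g letter list \<times> 'g letter list) set" where
  "pres_equiv S R = (pres_step S R \<union> (pres_step S R)\<inverse>)\<^sup>*"

definition presented_group :: "'g set \<Rightarrow> 'g letter list set \<Rightarrow> 'g letter list set monoid" where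
  "presented_group S R =
    \<lparr> carrier = lists (S \<times> UNIV) // pres_equiv S R,
      mult = (\<lambda>A B. \<Union>a\<in>A. \<Union>b\<in>B. pres_equiv S R `` {a @ b}),
      one = pres_equiv S R `` {[]} \<rparr>"

text \<open>Generators Inl 0..Inl m form a free basis of F_{m+1}, Inr 0..Inr n of F_{n+1};
  the generator of Z is sent to w1 resp. w2, giving the presentation
  \<langle>a_0..a_m, b_0..b_n | w1(a) = w2(b)\<rangle>.\<close>

definition amalg_group :: "nat \<Rightarrow> nat \<Rightarrow> nat letter list \<Rightarrow> nat letter list
    \<Rightarrow> (nat + nat) letter list set monoid" where
  "amalg_group m n w1 w2 =
     presented_group (Inl ` {..m} \<union> Inr ` {..n})
       {map (apfst Inl) w1 @ inv_word (map (apfst Inr) w2)}"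

definition amenable_action :: "('a, 'b) monoid_scheme \<Rightarrow> nat set \<Rightarrow> ('a \<Rightarrow> nat \<Rightarrow> nat) \<Rightarrow> bool" where
  "amenable_action G X \<phi> =
    (\<exists>A :: nat \<Rightarrow> nat set. (\<forall>k. finite (A k) \<and> A k \<noteq> {} \<and> A k \<subseteq> X) \<and>
       (\<forall>g\<in>carrier G. (\<lambda>k. real (card ((A k - \<phi> g ` A k) \<union> (\<phi> g ` A k - A k))) / real (card (A k)))
                         \<longlonglongrightarrow> 0))"

definition class_A :: "('a, 'b) monoid_scheme \<Rightarrow> bool" where
  "class_A G =
    (countable (carrier G) \<and>
     (\<exists>(X :: nat set) (\<phi> :: 'a \<Rightarrow> nat \<Rightarrow> nat).
        infinite X \<and> group_action G X \<phi> \<and>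
        inj_on \<phi> (carrier G) \<and>
        (\<forall>x\<in>X. \<forall>y\<in>X. \<exists>g\<in>carrier G. \<phi> g x = y) \<and>
        amenable_action G X \<phi>))"

end

theory Submission
  imports Defs
begin

text \<open>
  Write \<open>w\<close> for the amalgamated element. There is a homomorphism \<open>\<chi>\<close> from \<open>G\<close> to the integers that
  kills \<open>w\<close> and is surjective on both free factors; it lets \<open>G\<close> act on the integers by translations,
  and \<open>w\<close> fixes every integer. On the other hand \<open>w\<close> fixes the base point \<open>q\<close> of the coset space
  \<open>G / \<langle>w\<rangle>\<close>. On the disjoint union of the two spaces, let the first free factor act as it stands
  and conjugate the action of the second one by the transposition of \<open>0\<close> and \<open>q\<close>: as \<open>w\<close> fixes both
  points, this is again an action of \<open>G\<close>. The orbit of \<open>0\<close> contains all integers and all of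
  \<open>G / \<langle>w\<rangle>\<close>. Long intervals of integers far away from \<open>0\<close> form a Foelner sequence. If \<open>h\<close> is an
  element no positive power of which conjugates a nontrivial power of \<open>w\<close> to a power of \<open>w\<close>, then a
  finite set of nontrivial elements of \<open>G\<close> moves \<open>h\<^sup>N q\<close>, and does so without meeting \<open>q\<close>, for all but
  finitely many \<open>N\<close>. Having common moved points for all finite sets of nontrivial elements is strong
  enough for faithfulness to pass to each orbit of each finite index subgroup, and one of these
  orbits is amenable.

  That such an \<open>h\<close> exists comes down to reduced words in the first free factor being nontrivial in \<open>G\<close>.
  This is seen on the product of the two free groups: as \<open>w\<close> has infinite order in each of them, the
  translation action of each factor can be extended to the other coordinate by a coboundary in such a
  way that \<open>w\<close> acts diagonally for both.
\<close>

section \<open>Passing to subgroups of finite index\<close>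

lemma card_Diff_Un_Diff_image:
  assumes "inj_on f (B \<union> C)"
  shows "card ((f ` B - f ` C) \<union> (f ` C - f ` B)) = card ((B - C) \<union> (C - B))"
proof -
  have "(f ` B - f ` C) \<union> (f ` C - f ` B) = f ` ((B - C) \<union> (C - B))"
    using assms unfolding inj_on_def by blast
  then show ?thesis
    using card_image[OF inj_on_subset[OF assms, of "(B - C) \<union> (C - B)"]] by auto
qed

text \<open>The action is on a whole type, so words can act without side conditions; the extensional
  maps of \<open>group_action\<close> enter only in \<open>class_A_on_orbit\<close>.\<close>

locale total_action = group G for G (structure) +
  fixes act :: "'a \<Rightarrow> 'x \<Rightarrow> 'x"
  assumes act_one [simp]: "act \<one> x = x"
    and act_mult: "\<lbrakk>g \<in> carrier G; h \<in> carrier G\<rbrakk> \<Longrightarrow> act (g \<otimes> h) x = act g (act h x)"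
begin

lemma act_inv_act [simp]: "g \<in> carrier G \<Longrightarrow> act (inv g) (act g x) = x"
  by (metis act_mult act_one inv_closed l_inv)

lemma act_act_inv [simp]: "g \<in> carrier G \<Longrightarrow> act g (act (inv g) x) = x"
  by (metis act_mult act_one inv_closed r_inv)

lemma inj_act: "g \<in> carrier G \<Longrightarrow> inj (act g)"
  by (metis act_inv_act injI)

text \<open>The local form of the Foelner condition. For a countable group it yields a Foelner
  sequence, and its failure supplies one explicit pair \<open>F\<close>,
  \<open>\<epsilon>\<close>.\<close>

definition Folner_on :: "'x set \<Rightarrow> bool" where
  "Folner_on Y \<longleftrightarrow> (\<forall>F \<epsilon>. finite F \<longrightarrow> F \<subseteq> carrier G \<longrightarrow> \<epsilon> > 0 \<longrightarrow>
     (\<exists>B. finite B \<and> B \<noteq> {} \<and> B \<subseteq> Y \<and>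
        (\<forall>g\<in>F. real (card ((B - act g ` B) \<union> (act g ` B - B))) \<le> \<epsilon> * real (card B))))"

text \<open>\<open>class_A\<close> asks for a set of naturals, so the countable orbit
  \<open>Y\<close> is enumerated by \<open>f\<close> and the action is carried along
  \<open>f\<close>.\<close>

lemma class_A_on_orbit:
  assumes countable: "countable (carrier G)" and Y: "infinite Y"
    and inv: "\<And>g y. \<lbrakk>g \<in> carrier G; y \<in> Y\<rbrakk> \<Longrightarrow> act g y \<in> Y"
    and trans: "\<And>x y. \<lbrakk>x \<in> Y; y \<in> Y\<rbrakk> \<Longrightarrow> \<exists>g\<in>carrier G. act g x = y"
    and faithful: "\<And>g. \<lbrakk>g \<in> carrier G; g \<noteq> \<one>\<rbrakk> \<Longrightarrow> \<exists>y\<in>Y. act g y \<noteq> y"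
    and folner: "Folner_on Y"
  shows "class_A G"
proof -
  obtain y0 where y0: "y0 \<in> Y"
    using Y by fastforce
  have "Y \<subseteq> (\<lambda>g. act g y0) ` carrier G"
    using trans[OF y0] by blast
  then have cY: "countable Y"
    using countable by (meson countable_image countable_subset)
  define f where "f = to_nat_on Y"
  define X where "X = f ` Y"
  define e where "e = inv_into Y f"
  have f_inj: "inj_on f Y"
    unfolding f_def using cY by (rule inj_on_to_nat_on)
  have ef [simp]: "e (f y) = y" if "y \<in> Y" for y
    unfolding e_def using f_inj that by simp
  \<comment> \<open>Restricted to \<open>X\<close>, because elements of \<open>BijGroup X\<close>
    are extensional.\<close>
  define \<phi> where "\<phi> = (\<lambda>g. \<lambda>x\<in>X. f (act g (e x)))"
  have \<phi>f [simp]: "\<phi> g (f y) = f (act g y)" if "y \<in> Y" for g y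
    using that by (simp add: \<phi>_def X_def)
  have \<phi>B: "\<phi> g \<in> carrier (BijGroup X)" if g: "g \<in> carrier G" for g
  proof -
    have "bij_betw (\<phi> g) X X"
      by (rule bij_betw_byWitness[where f' = "\<phi> (inv g)"])
        (use g inv in \<open>auto simp: X_def\<close>)
    then show ?thesis
      by (simp add: BijGroup_def Bij_def \<phi>_def)
  qed
  have hom: "\<phi> \<in> hom G (BijGroup X)"
  proof (rule homI)
    fix g h assume gh: "g \<in> carrier G" "h \<in> carrier G"
    have "\<phi> (g \<otimes> h) = compose X (\<phi> g) (\<phi> h)"
    proof
      fix x show "\<phi> (g \<otimes> h) x = compose X (\<phi> g) (\<phi> h) x"
      proof (cases "x \<in> X")
        case True
        then obtain y where "y \<in> Y" "x = f y" by (auto simp: X_def)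
        then show ?thesis
          using gh inv by (auto simp: compose_def act_mult X_def)
      qed (simp add: \<phi>_def compose_def)
    qed
    then show "\<phi> (g \<otimes> h) = \<phi> g \<otimes>\<^bsub>BijGroup X\<^esub> \<phi> h"
      using \<phi>B gh by (simp add: BijGroup_def)
  qed (rule \<phi>B)
  have "group_action G X \<phi>"
    by (simp add: group_action_def group_hom_def group_hom_axioms_def hom group_BijGroup is_group)
  moreover have "infinite X"
    using Y f_inj by (simp add: X_def finite_image_iff)
  moreover have "inj_on \<phi> (carrier G)"
  proof (rule inj_onI, rule ccontr)
    fix g h assume gh: "g \<in> carrier G" "h \<in> carrier G" and eq: "\<phi> g = \<phi> h" and "g \<noteq> h"
    then have "inv g \<otimes> h \<noteq> \<one>"
      by (metis inv_equality inv_inv inv_closed)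
    then obtain y where y: "y \<in> Y" "act (inv g \<otimes> h) y \<noteq> y"
      using faithful gh by (meson inv_closed m_closed)
    have "f (act g y) = f (act h y)"
      using eq \<phi>f y(1) by metis
    then have "act g y = act h y"
      using f_inj inv gh y(1) by (meson inj_onD)
    then show False
      using y(2) gh by (metis act_inv_act act_mult inv_closed)
  qed
  moreover have "\<forall>x\<in>X. \<forall>y\<in>X. \<exists>g\<in>carrier G. \<phi> g x = y"
    using trans by (fastforce simp: X_def)
  moreover have "amenable_action G X \<phi>"
  proof -
    \<comment> \<open>Diagonal choice: each group element lies in \<open>F k\<close> from some
      \<open>k\<close> on, while the tolerance 1/(k+1) tends to 0.\<close>
    define F where "F = (\<lambda>k::nat. from_nat_into (carrier G) ` {..k})"
    have F: "finite (F k)" "F k \<subseteq> carrier G" for k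
      using from_nat_into[of "carrier G"] by (auto simp: F_def)
    have "\<exists>B. finite B \<and> B \<noteq> {} \<and> B \<subseteq> Y \<and> (\<forall>g\<in>F k.
        real (card ((B - act g ` B) \<union> (act g ` B - B))) \<le> inverse (real (Suc k)) * real (card B))" for k
      using folner F[of k] unfolding Folner_on_def by (metis inverse_positive_iff_positive of_nat_0_less_iff zero_less_Suc)
    then obtain B where B: "\<And>k. finite (B k)" "\<And>k. B k \<noteq> {}" "\<And>k. B k \<subseteq> Y"
      "\<And>k g. g \<in> F k \<Longrightarrow> real (card ((B k - act g ` B k) \<union> (act g ` B k - B k)))
          \<le> inverse (real (Suc k)) * real (card (B k))"
      by metis
    have "(\<lambda>k. real (card ((f ` B k - \<phi> g ` f ` B k) \<union> (\<phi> g ` f ` B k - f ` B k))) / real (card (f ` B k)))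
        \<longlonglongrightarrow> 0" (is "?r \<longlonglongrightarrow> 0") if g: "g \<in> carrier G" for g
    proof (rule tendsto_sandwich[OF _ _ tendsto_const LIMSEQ_inverse_real_of_nat])
      show "\<forall>\<^sub>F k in sequentially. 0 \<le> ?r k" by simp
      obtain k0 where k0: "from_nat_into (carrier G) k0 = g"
        using from_nat_into_surj[OF countable g] by blast
      show "\<forall>\<^sub>F k in sequentially. ?r k \<le> inverse (real (Suc k))"
        unfolding eventually_sequentially
      proof (intro exI allI impI)
        fix k assume "k0 \<le> k"
        then have gk: "g \<in> F k" by (auto simp: F_def k0[symmetric])
        have im: "\<phi> g ` f ` B k = f ` act g ` B k"
          unfolding image_image using B(3)[of k] by (intro image_cong) auto
        have sub: "B k \<union> act g ` B k \<subseteq> Y"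
          using B(3)[of k] inv g by auto
        have "card (f ` B k) = card (B k)"
          by (rule card_image, rule inj_on_subset[OF f_inj B(3)])
        moreover have "card (B k) > 0"
          using B(1,2) by (simp add: card_gt_0_iff)
        moreover note card_Diff_Un_Diff_image[OF inj_on_subset[OF f_inj sub]] B(4)[OF gk]
        ultimately show "?r k \<le> inverse (real (Suc k))"
          by (simp add: im divide_le_eq)
      qed
    qed
    then show ?thesis
      unfolding amenable_action_def X_def using B(1,2) image_mono[OF B(3), of f]
      by (intro exI[of _ "\<lambda>k. f ` B k"]) simp
  qed
  ultimately show ?thesis
    unfolding class_A_def using countable by blast
qed

text \<open>A single orbit of the subgroup does the job: if every orbit failed the Foelner condition, the
  failures would add up over the finitely many orbits; and a point that is moved by all conjugates
  of an element under coset representatives shows that the element acts nontrivially on each orbit.\<close>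

lemma not_Folner_onD:
  assumes "\<not> Folner_on Y"
  shows "\<exists>F \<epsilon>. finite F \<and> F \<subseteq> carrier G \<and> \<epsilon> > 0 \<and> (\<forall>B. finite B \<longrightarrow> B \<noteq> {} \<longrightarrow> B \<subseteq> Y \<longrightarrow>
    (\<exists>g\<in>F. real (card ((B - act g ` B) \<union> (act g ` B - B))) > \<epsilon> * real (card B)))"
  using assms unfolding Folner_on_def by (simp add: not_le) metis

lemma finite_index_subgroup_class_A:
  assumes countable: "countable (carrier G)" and X: "X = (\<lambda>g. act g x0) ` carrier G" "infinite X"
    and free: "\<And>F. \<lbrakk>finite F; F \<subseteq> carrier G - {\<one>}\<rbrakk> \<Longrightarrow> \<exists>x\<in>X. \<forall>g\<in>F. act g x \<noteq> x"
    and folner: "Folner_on X"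
    and H: "subgroup H G" and fin: "finite (rcosets H)"
  shows "class_A (G\<lparr>carrier := H\<rparr>)"
proof -
  interpret H: subgroup H G by (rule H)
  interpret GH: total_action "G\<lparr>carrier := H\<rparr>" act
  proof (intro total_action.intro total_action_axioms.intro)
    show "group (G\<lparr>carrier := H\<rparr>)" using is_group by (rule H.subgroup_is_group)
    show "act \<one>\<^bsub>G\<lparr>carrier := H\<rparr>\<^esub> x = x" for x by simp
    show "act (g \<otimes>\<^bsub>G\<lparr>carrier := H\<rparr>\<^esub> h) x = act g (act h x)"
      if "g \<in> carrier (G\<lparr>carrier := H\<rparr>)" "h \<in> carrier (G\<lparr>carrier := H\<rparr>)" for g h x
      using that act_mult[of g h x] by simp
  qed
  \<comment> \<open>Finitely many right cosets \<open>H #> r\<close> cover the group, so the orbit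
    of \<open>x0\<close> splits into finitely many orbits of \<open>H\<close>, collected in
    \<open>\<O>\<close> below.\<close>
  obtain R where R: "finite R" "R \<subseteq> carrier G" "rcosets H = (\<lambda>r. H #> r) ` R"
  proof -
    have "rcosets H \<subseteq> (\<lambda>r. H #> r) ` carrier G"
      by (auto simp: RCOSETS_def)
    then show ?thesis
      using that finite_subset_image[OF fin] by metis
  qed
  have decomp: "\<exists>r\<in>R. \<exists>h\<in>H. g = h \<otimes> r" if "g \<in> carrier G" for g
  proof -
    have "H #> g \<in> rcosets H"
      using that by (auto simp: RCOSETS_def)
    then obtain r where r: "r \<in> R" "H #> g = H #> r"
      unfolding R(3) by blast
    have "g \<in> H #> g"
      using that H by (rule rcos_self)
    then show ?thesis
      unfolding r(2) using r(1) by (auto simp: r_coset_def)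
  qed
  define orb where "orb x = (\<lambda>h. act h x) ` H" for x
  have orb_le: "orb (act h x) \<subseteq> orb x" if "h \<in> H" for h x
    unfolding orb_def using that by (auto simp: act_mult[symmetric])
  have orb_eq: "orb (act h x) = orb x" if h: "h \<in> H" for h x
    using orb_le[OF h, of x] orb_le[of "inv h" "act h x"] h by auto
  have orb_self: "x \<in> orb x" for x
    unfolding orb_def using H.one_closed act_one by (metis imageI)
  have orb_disj: "orb x = orb y" if "z \<in> orb x" "z \<in> orb y" for x y z
  proof -
    have "orb z = orb u" if "z \<in> orb u" for u
      using that orb_eq by (auto simp: orb_def[of u])
    then show ?thesis using that by metis
  qed
  have X_inv: "act g x \<in> X" if x: "x \<in> X" and g: "g \<in> carrier G" for g x
  proof -
    obtain k where "k \<in> carrier G" "x = act k x0" using x unfolding X(1) by blast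
    then show ?thesis unfolding X(1) using g by (intro image_eqI[of _ _ "g \<otimes> k"]) (auto simp: act_mult)
  qed
  define \<O> where "\<O> = (\<lambda>r. orb (act r x0)) ` R"
  have \<O>_fin: "finite \<O>"
    using R by (simp add: \<O>_def)
  have cover: "\<exists>Q\<in>\<O>. x \<in> Q" if x: "x \<in> X" for x
  proof -
    obtain g where g: "g \<in> carrier G" "x = act g x0"
      using x unfolding X(1) by blast
    then obtain r h where rh: "r \<in> R" "h \<in> H" "g = h \<otimes> r"
      using decomp by blast
    then have "x = act h (act r x0)"
      using g(2) R(2) act_mult[of h r x0] H.mem_carrier[of h] by auto
    then have "x \<in> orb (act r x0)"
      unfolding orb_def using rh(2) by (rule image_eqI)
    moreover have "orb (act r x0) \<in> \<O>"
      unfolding \<O>_def using rh(1) by (rule imageI)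
    ultimately show ?thesis by (rule bexI)
  qed
  have orb_act: "act h z \<in> orb x" if "z \<in> orb x" "h \<in> H" for h z x
    using orb_le[OF that(2), of z] orb_disj[OF that(1) orb_self] orb_self[of "act h z"] by auto
  have \<O>_inv: "act h ` Q = Q" if Q: "Q \<in> \<O>" and h: "h \<in> H" for Q h
  proof -
    obtain x where Q: "Q = orb x" using Q by (auto simp: \<O>_def)
    have "act k ` Q \<subseteq> Q" if "k \<in> H" for k
      using orb_act[OF _ that] by (auto simp: Q)
    then have "act h ` Q \<subseteq> Q" "act (inv h) ` Q \<subseteq> Q"
      using h by auto
    moreover from this(2) have "act h ` act (inv h) ` Q \<subseteq> act h ` Q"
      by (rule image_mono)
    ultimately show ?thesis
      using h by (simp add: image_image)
  qed
  have \<O>_disj: "Q = Q'" if Q: "Q \<in> \<O>" "Q' \<in> \<O>" and z: "z \<in> Q" "z \<in> Q'" for Q Q' z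
  proof -
    obtain r r' where "Q = orb (act r x0)" "Q' = orb (act r' x0)"
      using Q by (auto simp: \<O>_def)
    then show ?thesis
      using z orb_disj[of z "act r x0" "act r' x0"] by simp
  qed
  have split: "card (\<Union>Q\<in>\<O>. D Q) = (\<Sum>Q\<in>\<O>. card (D Q))" if "\<And>Q. D Q \<subseteq> Q" "\<And>Q. finite (D Q)" for D
  proof (rule card_UN_disjoint[OF \<O>_fin])
    show "\<forall>Q\<in>\<O>. \<forall>Q'\<in>\<O>. Q \<noteq> Q' \<longrightarrow> D Q \<inter> D Q' = {}"
    proof (intro ballI impI equals0I)
      fix Q Q' z assume "Q \<in> \<O>" "Q' \<in> \<O>" "Q \<noteq> Q'" "z \<in> D Q \<inter> D Q'"
      then show False
        using \<O>_disj[of Q Q' z] that(1)[of Q] that(1)[of Q'] by auto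
    qed
  qed (use that in auto)
  have UN_cover: "D = (\<Union>Q\<in>\<O>. D \<inter> Q)" if "D \<subseteq> X" for D
    unfolding Int_UN_distrib[symmetric] using that cover by (auto simp: Union_eq)
  have "\<exists>Q\<in>\<O>. GH.Folner_on Q"
  proof (rule ccontr)
    assume "\<not> ?thesis"
    then have "\<exists>F \<epsilon>. finite F \<and> F \<subseteq> H \<and> \<epsilon> > 0 \<and> (\<forall>B. finite B \<longrightarrow> B \<noteq> {} \<longrightarrow> B \<subseteq> Q \<longrightarrow>
        (\<exists>g\<in>F. real (card ((B - act g ` B) \<union> (act g ` B - B))) > \<epsilon> * real (card B)))" if "Q \<in> \<O>" for Q
      using that GH.not_Folner_onD[of Q] by auto
    then obtain F \<epsilon> where F: "\<And>Q. Q \<in> \<O> \<Longrightarrow> finite (F Q)" "\<And>Q. Q \<in> \<O> \<Longrightarrow> F Q \<subseteq> H"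
      and \<epsilon>: "\<And>Q. Q \<in> \<O> \<Longrightarrow> \<epsilon> Q > (0::real)"
      and bad: "\<And>Q B. \<lbrakk>Q \<in> \<O>; finite B; B \<noteq> {}; B \<subseteq> Q\<rbrakk> \<Longrightarrow>
        \<exists>g\<in>F Q. real (card ((B - act g ` B) \<union> (act g ` B - B))) > \<epsilon> Q * real (card B)"
      by metis
    define F' where "F' = (\<Union>Q\<in>\<O>. F Q)"
    have F': "finite F'" "F' \<subseteq> H"
      using F \<O>_fin by (auto simp: F'_def)
    \<comment> \<open>A common lower bound for the defects of all orbits; the inserted 1 keeps the
      argument of \<open>Min\<close> nonempty.\<close>
    define \<delta> where "\<delta> = Min (insert 1 (\<epsilon> ` \<O>))"
    have \<delta>: "\<delta> > 0" "\<And>Q. Q \<in> \<O> \<Longrightarrow> \<delta> \<le> \<epsilon> Q"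
      using \<epsilon> \<O>_fin by (auto simp: \<delta>_def)
    \<comment> \<open>This tolerance, summed over all of \<open>F'\<close>, stays at most
      \<open>\<delta>\<close>; the added 1 excludes division by zero.\<close>
    have "\<delta> / (real (card F') + 1) > 0"
      using \<delta>(1) by (intro divide_pos_pos) auto
    moreover have "F' \<subseteq> carrier G"
      using F'(2) by auto
    ultimately obtain B where B: "finite B" "B \<noteq> {}" "B \<subseteq> X"
      "\<And>g. g \<in> F' \<Longrightarrow> real (card ((B - act g ` B) \<union> (act g ` B - B))) \<le> \<delta> / (real (card F') + 1) * real (card B)"
      using folner F'(1) unfolding Folner_on_def by meson
    define d where "d Q g = ((B \<inter> Q) - act g ` (B \<inter> Q)) \<union> (act g ` (B \<inter> Q) - (B \<inter> Q))" for Q g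
    have card_B: "card B = (\<Sum>Q\<in>\<O>. card (B \<inter> Q))"
    proof -
      have "B = (\<Union>Q\<in>\<O>. B \<inter> Q)"
        using B(3) by (rule UN_cover)
      then show ?thesis using split[of "\<lambda>Q. B \<inter> Q"] B(1) by simp
    qed
    have card_d: "card ((B - act g ` B) \<union> (act g ` B - B)) = (\<Sum>Q\<in>\<O>. card (d Q g))" if g: "g \<in> H" for g
    proof -
      \<comment> \<open>Elements of \<open>H\<close> permute each orbit \<open>Q\<close>, so the
        symmetric difference can be computed orbit by orbit.\<close>
      have im: "act g ` (B \<inter> Q) = act g ` B \<inter> Q" if "Q \<in> \<O>" for Q
        using \<O>_inv[OF that g] image_Int[OF inj_act[of g], of B Q] g by auto
      then have dQ: "d Q g = ((B - act g ` B) \<union> (act g ` B - B)) \<inter> Q" if "Q \<in> \<O>" for Q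
        using that by (auto simp: d_def)
      have "(B - act g ` B) \<union> (act g ` B - B) \<subseteq> X"
        using B(3) X_inv g by auto
      then have "(B - act g ` B) \<union> (act g ` B - B) = (\<Union>Q\<in>\<O>. ((B - act g ` B) \<union> (act g ` B - B)) \<inter> Q)"
        by (rule UN_cover)
      also have "card \<dots> = (\<Sum>Q\<in>\<O>. card (((B - act g ` B) \<union> (act g ` B - B)) \<inter> Q))"
        using B(1) by (intro split) auto
      finally show ?thesis using dQ by simp
    qed
    have low: "real (\<Sum>g\<in>F'. card (d Q g)) \<ge> \<delta> * real (card (B \<inter> Q))"
      and low': "B \<inter> Q \<noteq> {} \<Longrightarrow> real (\<Sum>g\<in>F'. card (d Q g)) > \<delta> * real (card (B \<inter> Q))" if Q: "Q \<in> \<O>" for Q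
    proof -
      show *: "real (\<Sum>g\<in>F'. card (d Q g)) > \<delta> * real (card (B \<inter> Q))" if ne: "B \<inter> Q \<noteq> {}"
      proof -
        obtain g where g: "g \<in> F Q" "real (card (d Q g)) > \<epsilon> Q * real (card (B \<inter> Q))"
          using bad[OF Q, of "B \<inter> Q"] B(1) ne by (auto simp: d_def)
        have "\<delta> * real (card (B \<inter> Q)) \<le> \<epsilon> Q * real (card (B \<inter> Q))"
          using \<delta>(2)[OF Q] by (intro mult_right_mono) auto
        also have "\<dots> < real (card (d Q g))" by (rule g)
        also have "\<dots> \<le> real (\<Sum>g\<in>F'. card (d Q g))"
          using g(1) Q F'(1) member_le_sum[of g F' "\<lambda>g. card (d Q g)"] by (auto simp: F'_def simp del: of_nat_sum)
        finally show ?thesis .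
      qed
      show "real (\<Sum>g\<in>F'. card (d Q g)) \<ge> \<delta> * real (card (B \<inter> Q))"
        by (cases "B \<inter> Q = {}") (use * in \<open>auto simp: sum_nonneg intro: less_imp_le\<close>)
    qed
    obtain b where "b \<in> B" using B(2) by blast
    then obtain Q where Q: "Q \<in> \<O>" "B \<inter> Q \<noteq> {}"
      using cover B(3) by blast
    \<comment> \<open>Double counting: the defects are summed over orbits, strictly on one that
      meets \<open>B\<close>; exchanging the sums leads to the tolerance over \<open>F'\<close>, a
      contradiction.\<close>
    have "\<delta> * real (card B) = (\<Sum>Q\<in>\<O>. \<delta> * real (card (B \<inter> Q)))"
      by (simp add: card_B sum_distrib_left)
    also have "\<dots> < (\<Sum>Q\<in>\<O>. real (\<Sum>g\<in>F'. card (d Q g)))"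
      using Q low low' \<O>_fin by (intro sum_strict_mono_ex1) auto
    also have "\<dots> = (\<Sum>g\<in>F'. real (\<Sum>Q\<in>\<O>. card (d Q g)))"
      unfolding of_nat_sum by (rule sum.swap)
    also have "\<dots> = (\<Sum>g\<in>F'. real (card ((B - act g ` B) \<union> (act g ` B - B))))"
      using F'(2) card_d by (intro sum.cong) auto
    also have "\<dots> \<le> (\<Sum>g\<in>F'. \<delta> / (real (card F') + 1) * real (card B))"
      by (intro sum_mono B(4))
    also have "\<dots> = \<delta> * real (card B) * (real (card F') / (real (card F') + 1))"
      by simp
    also have "\<dots> \<le> \<delta> * real (card B) * 1"
      using \<delta>(1) by (intro mult_left_mono) auto
    finally show False by simp
  qed
  then obtain r where r: "r \<in> R" and folner_r: "GH.Folner_on (orb (act r x0))"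
    by (auto simp: \<O>_def)
  have rG: "r \<in> carrier G" using r R(2) by blast
  define y where "y = act r x0"
  have yX: "y \<in> X" using rG by (auto simp: y_def X(1))
  \<comment> \<open>The element \<open>r \<otimes> inv g\<close> sends \<open>x\<close> to
    \<open>y\<close>. Split as \<open>h \<otimes> s\<close>, it shows that the representative
    \<open>s\<close> already brings \<open>x\<close> into the \<open>H\<close>-orbit of
    \<open>y\<close>.\<close>
  have orbit_y: "\<exists>s\<in>R. act s x \<in> orb y" if x: "x \<in> X" for x
  proof -
    obtain g where g: "g \<in> carrier G" "x = act g x0" using x unfolding X(1) by blast
    define k where "k = r \<otimes> inv g"
    have k: "k \<in> carrier G" "act k x = y"
      using g rG by (auto simp: k_def y_def act_mult)
    obtain s h where sh: "s \<in> R" "h \<in> H" "k = h \<otimes> s"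
      using decomp k(1) by blast
    have "s \<in> carrier G" using sh R by blast
    then have "y = act h (act s x)" using k sh by (auto simp: act_mult)
    then have "orb y = orb (act s x)" using orb_eq sh(2) by simp
    then show ?thesis using sh(1) orb_self by blast
  qed
  have "infinite (orb y)"
  proof
    assume f: "finite (orb y)"
    have "X \<subseteq> (\<Union>s\<in>R. act (inv s) ` orb y)"
    proof
      fix x assume "x \<in> X"
      then obtain s where s: "s \<in> R" "act s x \<in> orb y" using orbit_y by blast
      then have "x = act (inv s) (act s x)" using R by auto
      with s show "x \<in> (\<Union>s\<in>R. act (inv s) ` orb y)" by blast
    qed
    then show False
      using X(2) f R(1) by (meson finite_UN finite_imageI finite_subset)
  qed
  moreover have "countable H"
    using countable H.subset by (rule countable_subset[rotated])
  moreover have "\<exists>z\<in>orb y. act h z \<noteq> z" if h: "h \<in> H" "h \<noteq> \<one>" for h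
  proof -
    \<comment> \<open>If \<open>x\<close> is moved by all these conjugates and \<open>s\<close>
      brings \<open>x\<close> into the chosen orbit, then \<open>h\<close> moves
      \<open>act s x\<close>.\<close>
    define F where "F = (\<lambda>s. inv s \<otimes> h \<otimes> s) ` R"
    have "inv s \<otimes> h \<otimes> s \<noteq> \<one>" if "s \<in> R" for s
    proof
      assume e: "inv s \<otimes> h \<otimes> s = \<one>"
      have c: "s \<in> carrier G" "h \<in> carrier G" using that R h by auto
      then have "h \<otimes> s = s \<otimes> (inv s \<otimes> h \<otimes> s)"
        by (simp add: m_assoc[symmetric])
      also have "\<dots> = s" using c by (simp add: e)
      finally show False using h c by simp
    qed
    then have "F \<subseteq> carrier G - {\<one>}" "finite F"
      using R h by (auto simp: F_def)
    then obtain x where x: "x \<in> X" "\<And>g. g \<in> F \<Longrightarrow> act g x \<noteq> x"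
      using free by meson
    obtain s where s: "s \<in> R" "act s x \<in> orb y" using orbit_y x(1) by blast
    have c: "s \<in> carrier G" "h \<in> carrier G" using s R h by auto
    have "act (inv s \<otimes> h \<otimes> s) x \<noteq> x" using x(2) s(1) by (auto simp: F_def)
    then have "act h (act s x) \<noteq> act s x" using c by (auto simp: act_mult)
    with s show ?thesis by blast
  qed
  moreover have "\<exists>g\<in>H. act g x = z" if "x \<in> orb y" "z \<in> orb y" for x z
  proof -
    have "orb y = orb x" using that(1) orb_self orb_disj by blast
    then have "z \<in> orb x" using that(2) by simp
    then show ?thesis by (auto simp: orb_def)
  qed
  moreover have "act g z \<in> orb y" if "g \<in> H" "z \<in> orb y" for g z
    using orb_act that by blast
  ultimately show ?thesis
    using folner_r unfolding y_def[symmetric] by (intro GH.class_A_on_orbit[of "orb y"]) auto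
qed

end

section \<open>Presented groups and their actions\<close>

text \<open>\<open>inv_into UNIV\<close> is a true inverse once the generators act bijectively, as
  the context below assumes.\<close>

definition letter_act :: "('g \<Rightarrow> 'x \<Rightarrow> 'x) \<Rightarrow> 'g letter \<Rightarrow> 'x \<Rightarrow> 'x" where
  "letter_act \<rho> l = (if snd l then inv_into UNIV (\<rho> (fst l)) else \<rho> (fst l))"

definition word_act :: "('g \<Rightarrow> 'x \<Rightarrow> 'x) \<Rightarrow> 'g letter list \<Rightarrow> 'x \<Rightarrow> 'x" where
  "word_act \<rho> w = foldr (letter_act \<rho>) w"

lemma inv_letter_inv_letter [simp]: "inv_letter (inv_letter l) = l"
  by (simp add: inv_letter_def)

lemma inv_letter_eq_iff [simp]: "inv_letter x = inv_letter y \<longleftrightarrow> x = y"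
  by (metis inv_letter_inv_letter)

lemma inv_letter_neq [simp]: "inv_letter l \<noteq> l" "l \<noteq> inv_letter l"
  by (simp_all add: inv_letter_def prod_eq_iff)

lemma inv_word_simps [simp]:
  "inv_word [] = []" "inv_word (u @ v) = inv_word v @ inv_word u"
  "inv_word (l # w) = inv_word w @ [inv_letter l]"
  by (simp_all add: inv_word_def)

lemma inv_word_inv_word [simp]: "inv_word (inv_word w) = w"
  by (induction w) auto

lemma inv_word_eq_Nil [simp]: "inv_word w = [] \<longleftrightarrow> w = []"
  by (simp add: inv_word_def)

lemma inv_word_lists [simp]: "inv_word w \<in> lists (S \<times> UNIV) \<longleftrightarrow> w \<in> lists (S \<times> UNIV)"
  by (auto simp: inv_word_def inv_letter_def in_lists_conv_set mem_Times_iff)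

lemma inv_word_map_apfst: "inv_word (map (apfst f) w) = map (apfst f) (inv_word w)"
  by (simp add: inv_word_def rev_map inv_letter_def comp_def)

lemma word_act_simps [simp]:
  "word_act \<rho> [] x = x" "word_act \<rho> (l # w) x = letter_act \<rho> l (word_act \<rho> w x)"
  by (simp_all add: word_act_def)

lemma word_act_append [simp]: "word_act \<rho> (u @ v) x = word_act \<rho> u (word_act \<rho> v x)"
  by (induction u) auto

lemma word_act_map_apfst: "word_act \<rho> (map (apfst f) w) x = word_act (\<lambda>s. \<rho> (f s)) w x"
  by (induction w) (auto simp: letter_act_def)

lemma word_act_concat_replicate: "word_act \<rho> (concat (replicate k w)) x = (word_act \<rho> w ^^ k) x"
  by (induction k) auto

context
  fixes \<rho> :: "'g \<Rightarrow> 'x \<Rightarrow> 'x"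
  assumes bij: "\<And>s. bij (\<rho> s)"
begin

lemma letter_act_cancel [simp]:
  "letter_act \<rho> (inv_letter l) (letter_act \<rho> l x) = x"
  "letter_act \<rho> l (letter_act \<rho> (inv_letter l) x) = x"
  using bij[of "fst l"] by (auto simp: letter_act_def inv_letter_def bij_is_inj bij_is_surj surj_f_inv_f)

lemma word_act_cancel [simp]:
  "word_act \<rho> (inv_word w) (word_act \<rho> w x) = x"
  "word_act \<rho> w (word_act \<rho> (inv_word w) x) = x"
  by (induction w arbitrary: x) auto

lemma bij_word_act: "bij (word_act \<rho> w)"
  by (rule bij_betw_byWitness[where f' = "word_act \<rho> (inv_word w)"]) auto

lemma word_act_inj: "word_act \<rho> w x = word_act \<rho> w y \<longleftrightarrow> x = y"
  by (metis word_act_cancel(1))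

text \<open>Each presentation step preserves the action: inverse letters cancel and relators act
  trivially. So bijections that respect the relators define an action of the presented
  group.\<close>

lemma word_act_pres_equiv:
  assumes R: "\<And>r y. r \<in> R \<Longrightarrow> word_act \<rho> r y = y" and "(u, v) \<in> pres_equiv S R"
  shows "word_act \<rho> u x = word_act \<rho> v x"
proof -
  have step: "word_act \<rho> u x = word_act \<rho> v x" if "(u, v) \<in> pres_step S R" for u v x
    using that R by cases auto
  show ?thesis
    using assms(2) unfolding pres_equiv_def
    by (induction rule: rtrancl_induct) (use step in auto)
qed

text \<open>Inner pairs of \<open>\<tau>'\<close> and \<open>\<tau>\<close> cancel along the word.
  This is used both for exchanging the coordinates of a product and for the transposition in the
  surgery.\<close>

lemma word_act_conj:
  assumes \<tau>: "\<And>y. \<tau> (\<tau>' y) = y" "\<And>x. \<tau>' (\<tau> x) = x"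
  shows "word_act (\<lambda>s. \<tau> \<circ> \<rho> s \<circ> \<tau>') w y = \<tau> (word_act \<rho> w (\<tau>' y))"
proof -
  have inv: "inv_into UNIV (\<tau> \<circ> \<rho> s \<circ> \<tau>') = \<tau> \<circ> inv_into UNIV (\<rho> s) \<circ> \<tau>'" for s
    using bij[of s] by (intro inv_unique_comp) (auto simp: \<tau> fun_eq_iff bij_is_inj bij_is_surj surj_f_inv_f)
  have "letter_act (\<lambda>s. \<tau> \<circ> \<rho> s \<circ> \<tau>') l y = \<tau> (letter_act \<rho> l (\<tau>' y))" for l y
    unfolding letter_act_def inv by simp
  then show ?thesis
    by (induction w) (auto simp: \<tau>)
qed

end

lemma bij_conj:
  assumes "\<And>y. \<tau> (\<tau>' y) = y" "\<And>x. \<tau>' (\<tau> x) = x" and "bij f"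
  shows "bij (\<tau> \<circ> f \<circ> \<tau>')"
proof -
  have "bij \<tau>" "bij \<tau>'"
    by (rule bij_betw_byWitness[where f' = \<tau>'], use assms(1,2) in auto)
      (rule bij_betw_byWitness[where f' = \<tau>], use assms(1,2) in auto)
  with assms(3) show ?thesis
    by (intro bij_comp)
qed

section \<open>The group of word classes\<close>

definition word_class :: "'g set \<Rightarrow> 'g letter list set \<Rightarrow> 'g letter list \<Rightarrow> 'g letter list set" where
  "word_class S R w = pres_equiv S R `` {w}"

lemma pres_equiv_refl [simp]: "(u, u) \<in> pres_equiv S R"
  by (simp add: pres_equiv_def)

lemma pres_equiv_sym: "(u, v) \<in> pres_equiv S R \<Longrightarrow> (v, u) \<in> pres_equiv S R"
  unfolding pres_equiv_def
  by (metis converse_Un converse_converse rtrancl_converseD rtrancl_converseI sup_commute)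

lemma pres_equiv_trans:
  "(u, v) \<in> pres_equiv S R \<Longrightarrow> (v, w) \<in> pres_equiv S R \<Longrightarrow> (u, w) \<in> pres_equiv S R"
  unfolding pres_equiv_def by (rule rtrancl_trans)

text \<open>\<open>pres_equiv\<close> is an equivalence on all words of the type, so words outside
  the alphabet are covered as well.\<close>

lemma word_class_eq_iff: "word_class S R u = word_class S R v \<longleftrightarrow> (u, v) \<in> pres_equiv S R"
  unfolding word_class_def using pres_equiv_refl pres_equiv_sym pres_equiv_trans
  by (auto, blast+)

lemma pres_equiv_lists:
  assumes "(u, v) \<in> pres_equiv S R"
  shows "u \<in> lists (S \<times> UNIV) \<longleftrightarrow> v \<in> lists (S \<times> UNIV)"
proof -
  have step: "u \<in> lists (S \<times> UNIV) \<and> v \<in> lists (S \<times> UNIV)" if "(u, v) \<in> pres_step S R" for u v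
    using that by cases (auto simp: inv_letter_def)
  show ?thesis
    using assms unfolding pres_equiv_def
    by (induction rule: rtrancl_induct) (use step in blast)+
qed

lemma pres_equiv_context:
  assumes "(u, v) \<in> pres_equiv S R" and a: "a \<in> lists (S \<times> UNIV)" "b \<in> lists (S \<times> UNIV)"
  shows "(a @ u @ b, a @ v @ b) \<in> pres_equiv S R"
proof -
  have step: "(a @ u @ b, a @ v @ b) \<in> pres_step S R" if "(u, v) \<in> pres_step S R" for u v
    using that
  proof cases
    case (cancel p q x)
    then show ?thesis
      using pres_step.cancel[of "a @ p" S "q @ b" x R] a by simp
  next
    case (relator p q r)
    then show ?thesis
      using pres_step.relator[of "a @ p" S "q @ b" r R] a by simp
  qed
  show ?thesis
    using assms(1) unfolding pres_equiv_def
  proof (induction rule: rtrancl_induct)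
    case (step y z)
    then have "(a @ y @ b, a @ z @ b) \<in> pres_step S R \<union> (pres_step S R)\<inverse>"
      using \<open>\<And>u v. (u, v) \<in> pres_step S R \<Longrightarrow> (a @ u @ b, a @ v @ b) \<in> pres_step S R\<close> by auto
    with step.IH show ?case by (rule rtrancl.rtrancl_into_rtrancl)
  qed simp
qed

text \<open>One factor is replaced at a time, inside a context over the alphabet. This makes
  multiplication of classes well defined.\<close>

lemma pres_equiv_append:
  assumes "(u, u') \<in> pres_equiv S R" "(v, v') \<in> pres_equiv S R" "u \<in> lists (S \<times> UNIV)" "v \<in> lists (S \<times> UNIV)"
  shows "(u @ v, u' @ v') \<in> pres_equiv S R"
  using pres_equiv_context[OF assms(1), of "[]" v] pres_equiv_context[OF assms(2), of u' "[]"]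
    pres_equiv_lists[OF assms(1)] assms(3,4) pres_equiv_trans by fastforce

lemma pres_equiv_inv_word:
  assumes "w \<in> lists (S \<times> UNIV)"
  shows "(inv_word w @ w, []) \<in> pres_equiv S R"
  using assms
proof (induction w)
  case (Cons l w)
  have "(inv_word w @ w, inv_word w @ [inv_letter l, inv_letter (inv_letter l)] @ w) \<in> pres_step S R"
    using Cons.hyps by (intro pres_step.cancel) (auto simp: inv_letter_def)
  then have "(inv_word (l # w) @ l # w, inv_word w @ w) \<in> pres_equiv S R"
    unfolding pres_equiv_def by auto
  with Cons.IH show ?case by (rule pres_equiv_trans[rotated])
qed simp

lemma presented_group_carrier: "carrier (presented_group S R) = word_class S R ` lists (S \<times> UNIV)"
  by (auto simp: presented_group_def word_class_def quotient_def)

lemma word_class_carrier: "w \<in> lists (S \<times> UNIV) \<Longrightarrow> word_class S R w \<in> carrier (presented_group S R)"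
  unfolding presented_group_carrier by (rule imageI)

lemma presented_group_one: "\<one>\<^bsub>presented_group S R\<^esub> = word_class S R []"
  by (simp add: presented_group_def word_class_def)

lemma presented_group_mult:
  assumes "u \<in> lists (S \<times> UNIV)" "v \<in> lists (S \<times> UNIV)"
  shows "word_class S R u \<otimes>\<^bsub>presented_group S R\<^esub> word_class S R v = word_class S R (u @ v)"
proof -
  have "pres_equiv S R `` {a @ b} = word_class S R (u @ v)"
    if "a \<in> word_class S R u" "b \<in> word_class S R v" for a b
    unfolding word_class_def[symmetric] word_class_eq_iff
    using that pres_equiv_append[of u a S R v b] assms pres_equiv_sym by (auto simp: word_class_def)
  moreover have "u \<in> word_class S R u" "v \<in> word_class S R v"
    by (auto simp: word_class_def)
  ultimately show ?thesis
    unfolding presented_group_def by auto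
qed

lemma presented_group_group: "group (presented_group S R)"
proof (rule groupI)
  let ?G = "presented_group S R"
  note simps = presented_group_one presented_group_mult word_class_eq_iff pres_equiv_inv_word
  show "\<one>\<^bsub>?G\<^esub> \<in> carrier ?G"
    unfolding presented_group_one by (rule word_class_carrier) simp
  fix x assume "x \<in> carrier ?G"
  then obtain u where u: "u \<in> lists (S \<times> UNIV)" "x = word_class S R u"
    unfolding presented_group_carrier by (rule imageE)
  show "\<one>\<^bsub>?G\<^esub> \<otimes>\<^bsub>?G\<^esub> x = x"
    using u by (simp add: simps)
  show "\<exists>y\<in>carrier ?G. y \<otimes>\<^bsub>?G\<^esub> x = \<one>\<^bsub>?G\<^esub>"
    using u word_class_carrier[of "inv_word u" S R]
    by (intro bexI[of _ "word_class S R (inv_word u)"]) (simp_all add: simps)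
  fix y assume "y \<in> carrier ?G"
  then obtain v where v: "v \<in> lists (S \<times> UNIV)" "y = word_class S R v"
    unfolding presented_group_carrier by (rule imageE)
  show "x \<otimes>\<^bsub>?G\<^esub> y \<in> carrier ?G"
    using u v word_class_carrier[of "u @ v" S R] by (simp add: simps)
  fix z assume "z \<in> carrier ?G"
  then obtain w where w: "w \<in> lists (S \<times> UNIV)" "z = word_class S R w"
    unfolding presented_group_carrier by (rule imageE)
  show "x \<otimes>\<^bsub>?G\<^esub> y \<otimes>\<^bsub>?G\<^esub> z = x \<otimes>\<^bsub>?G\<^esub> (y \<otimes>\<^bsub>?G\<^esub> z)"
    using u v w by (simp add: simps)
qed

lemma presented_group_inv:
  assumes "w \<in> lists (S \<times> UNIV)"
  shows "inv\<^bsub>presented_group S R\<^esub> word_class S R w = word_class S R (inv_word w)"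
proof -
  interpret group "presented_group S R" by (rule presented_group_group)
  show ?thesis
    using assms by (intro inv_equality word_class_carrier)
      (simp_all add: presented_group_one presented_group_mult word_class_eq_iff
        pres_equiv_inv_word)
qed

lemma presented_group_pow:
  assumes "w \<in> lists (S \<times> UNIV)"
  shows "word_class S R w [^]\<^bsub>presented_group S R\<^esub> (k :: nat) = word_class S R (concat (replicate k w))"
proof (induction k)
  case (Suc k)
  have "concat (replicate k w) \<in> lists (S \<times> UNIV)"
    using assms by (induction k) auto
  moreover have "concat (replicate k w) @ w = w @ concat (replicate k w)"
    by (induction k) auto
  ultimately show ?case
    using Suc assms by (simp add: nat_pow_def presented_group_mult)
qed (simp add: nat_pow_def presented_group_one)

lemma presented_group_relator:
  assumes "r \<in> R" "r \<in> lists (S \<times> UNIV)"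
  shows "word_class S R r = \<one>\<^bsub>presented_group S R\<^esub>"
proof -
  have "([] @ [], [] @ r @ []) \<in> pres_step S R"
    using assms by (intro pres_step.relator) auto
  then show ?thesis
    by (auto simp: presented_group_one word_class_eq_iff pres_equiv_def)
qed

text \<open>The representative is arbitrary; \<open>lift_act_word_class\<close> shows independence
  of it when generators act bijectively and relators trivially.\<close>

definition lift_act :: "('g \<Rightarrow> 'x \<Rightarrow> 'x) \<Rightarrow> 'g letter list set \<Rightarrow> 'x \<Rightarrow> 'x" where
  "lift_act \<rho> C = word_act \<rho> (SOME w. w \<in> C)"

lemma lift_act_word_class:
  assumes "\<And>s. bij (\<rho> s)" and "\<And>r y. r \<in> R \<Longrightarrow> word_act \<rho> r y = y"
  shows "lift_act \<rho> (word_class S R w) x = word_act \<rho> w x"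
proof -
  have "w \<in> word_class S R w" by (simp add: word_class_def)
  then have "(SOME v. v \<in> word_class S R w) \<in> word_class S R w" by (rule someI)
  then have "(w, SOME v. v \<in> word_class S R w) \<in> pres_equiv S R" by (simp add: word_class_def)
  then show ?thesis
    unfolding lift_act_def using word_act_pres_equiv[OF assms] by simp
qed

section \<open>Reduced words in the amalgam\<close>

lemma reduced_word_iff_successively:
  "reduced_word w \<longleftrightarrow> successively (\<lambda>x y. y \<noteq> inv_letter x) w"
  by (simp add: reduced_word_def successively_conv_nth)

lemma reduced_word_simps [simp]:
  "reduced_word []" "reduced_word [l]"
  "reduced_word (x # y # w) \<longleftrightarrow> y \<noteq> inv_letter x \<and> reduced_word (y # w)"
  by (simp_all add: reduced_word_iff_successively)

lemma reduced_word_append: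
  "reduced_word (u @ v) \<longleftrightarrow> reduced_word u \<and> reduced_word v \<and>
    (u = [] \<or> v = [] \<or> hd v \<noteq> inv_letter (last u))"
  by (auto simp: reduced_word_iff_successively successively_append_iff)

lemma reduced_word_Cons:
  "reduced_word (x # w) \<longleftrightarrow> reduced_word w \<and> (w = [] \<or> hd w \<noteq> inv_letter x)"
  by (cases w) auto

lemma hd_inv_word: "w \<noteq> [] \<Longrightarrow> hd (inv_word w) = inv_letter (last w)"
  by (simp add: inv_word_def hd_rev last_map)

lemma last_inv_word: "w \<noteq> [] \<Longrightarrow> last (inv_word w) = inv_letter (hd w)"
  by (simp add: inv_word_def last_rev hd_map)

lemma reduced_inv_word: "reduced_word w \<Longrightarrow> reduced_word (inv_word w)"
proof (induction w)
  case (Cons l w)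
  then show ?case
    by (cases "w = []") (auto simp: reduced_word_append reduced_word_Cons last_inv_word)
qed simp

lemma cyclically_reduced_inv_word: "cyclically_reduced w \<Longrightarrow> cyclically_reduced (inv_word w)"
  by (auto simp: cyclically_reduced_def reduced_inv_word hd_inv_word last_inv_word)

lemma hd_concat_replicate: "k > 0 \<Longrightarrow> w \<noteq> [] \<Longrightarrow> hd (concat (replicate k w)) = hd w"
  by (cases k) auto

lemma last_concat_replicate: "k > 0 \<Longrightarrow> w \<noteq> [] \<Longrightarrow> last (concat (replicate k w)) = last w"
proof (induction k)
  case (Suc k)
  then show ?case by (cases "k = 0") (auto simp: last_append)
qed simp

lemma reduced_concat_replicate:
  assumes "cyclically_reduced w"
  shows "reduced_word (concat (replicate k w))"
proof (induction k)
  case (Suc k)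
  have "hd w \<noteq> inv_letter (last w)" if "w \<noteq> []"
    using assms that by (metis cyclically_reduced_def inv_letter_inv_letter)
  with Suc show ?case
    using assms by (cases "w = [] \<or> k = 0")
      (auto simp: reduced_word_append cyclically_reduced_def hd_concat_replicate)
qed simp

section \<open>The free group acting on its reduced words\<close>

typedef 'g free_word = "{w :: 'g letter list. reduced_word w}"
  by (rule exI[of _ "[]"]) simp

definition reduce_Cons :: "'g letter \<Rightarrow> 'g letter list \<Rightarrow> 'g letter list" where
  "reduce_Cons l w = (if w \<noteq> [] \<and> hd w = inv_letter l then tl w else l # w)"

lemma reduced_reduce_Cons: "reduced_word w \<Longrightarrow> reduced_word (reduce_Cons l w)"
  by (cases w) (auto simp: reduce_Cons_def reduced_word_Cons)

lemma reduce_Cons_cancel: "reduced_word w \<Longrightarrow> reduce_Cons (inv_letter l) (reduce_Cons l w) = w"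
  by (cases w) (auto simp: reduce_Cons_def reduced_word_Cons)

lemma two_sided_inverse:
  assumes "\<And>x. f (g x) = x" "\<And>x. g (f x) = x"
  shows "bij g" "inv_into UNIV g x = f x"
proof -
  show "bij g"
    by (rule bij_betw_byWitness[where f' = f]) (use assms in auto)
  then show "inv_into UNIV g x = f x"
    using assms(2) by (metis bij_is_inj inv_f_f)
qed

text \<open>Left multiplication by a generator of the free group. Since reduced words form a type of
  their own, it is a bijection of a whole type.\<close>

definition free_act :: "'g \<Rightarrow> 'g free_word \<Rightarrow> 'g free_word" where
  "free_act s x = Abs_free_word (reduce_Cons (s, False) (Rep_free_word x))"

lemma reduced_Rep_free_word: "reduced_word (Rep_free_word x)"
  using Rep_free_word by simp

lemma Rep_Abs_free_word: "reduced_word w \<Longrightarrow> Rep_free_word (Abs_free_word w) = w"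
  by (simp add: Abs_free_word_inverse)

lemma free_act_left_inverse:
  "Abs_free_word (reduce_Cons (inv_letter l) (Rep_free_word (Abs_free_word (reduce_Cons l (Rep_free_word x))))) = x"
  by (simp add: Rep_Abs_free_word reduced_reduce_Cons reduced_Rep_free_word reduce_Cons_cancel Rep_free_word_inverse)

lemma bij_free_act: "bij (free_act s)"
  and inv_free_act: "inv_into UNIV (free_act s) x = Abs_free_word (reduce_Cons (s, True) (Rep_free_word x))"
proof -
  define f where "f = (\<lambda>x. Abs_free_word (reduce_Cons (s, True) (Rep_free_word x)))"
  have "f (free_act s x) = x" "free_act s (f x) = x" for x
    using free_act_left_inverse[of "(s, False)" x] free_act_left_inverse[of "(s, True)" x]
    by (simp_all add: f_def free_act_def inv_letter_def)
  then show "bij (free_act s)" "inv_into UNIV (free_act s) x = f x"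
    by (rule two_sided_inverse)+
qed

lemma letter_act_free_act: "letter_act free_act l x = Abs_free_word (reduce_Cons l (Rep_free_word x))"
  by (cases l) (auto simp: letter_act_def inv_free_act free_act_def)

lemma word_act_free_act_Nil:
  "reduced_word w \<Longrightarrow> word_act free_act w (Abs_free_word []) = Abs_free_word w"
proof (induction w)
  case (Cons l w)
  then show ?case
    by (auto simp: letter_act_free_act reduced_word_Cons Rep_Abs_free_word reduce_Cons_def)
qed simp

text \<open>The image of the empty word is the reduced form of \<open>w\<close>, and cancelling a
  pair of letters does not change the action. So the effect on the empty word determines the effect
  on every point.\<close>

lemma word_act_free_act_reduce:
  "word_act free_act w x = word_act free_act (Rep_free_word (word_act free_act w (Abs_free_word []))) x"
proof (induction w)
  case (Cons l w)
  define r where "r = Rep_free_word (word_act free_act w (Abs_free_word []))"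
  have "word_act free_act (reduce_Cons l r) x = letter_act free_act l (word_act free_act r x)"
    using letter_act_cancel[of free_act "inv_letter l", OF bij_free_act]
      letter_act_cancel[of free_act "l", OF bij_free_act]
    by (cases r) (auto simp: reduce_Cons_def)
  then show ?case
    using Cons by (simp add: letter_act_free_act[of l "word_act free_act w (Abs_free_word [])"]
      r_def[symmetric] Rep_Abs_free_word reduced_reduce_Cons reduced_Rep_free_word)
     (simp add: r_def Rep_Abs_free_word reduced_reduce_Cons reduced_Rep_free_word)
qed (simp add: Rep_Abs_free_word)

text \<open>Conjugated by the word \<open>v\<close> of the point \<open>x\<close>, \<open>u\<close>
  fixes the empty word and hence acts as the identity. So \<open>u\<close> itself fixes the empty
  word, but being reduced it sends that word to \<open>u\<close>.\<close>

lemma free_act_free: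
  assumes "reduced_word u" "word_act free_act u x = x"
  shows "u = []"
proof -
  define v where "v = Rep_free_word x"
  define e :: "'a free_word" where "e = Abs_free_word []"
  note [simp] = word_act_cancel[of free_act, OF bij_free_act]
  have x: "x = word_act free_act v e"
    by (simp add: v_def e_def word_act_free_act_Nil reduced_Rep_free_word Rep_free_word_inverse)
  have "word_act free_act (inv_word v @ u @ v) e = e"
    using assms(2) by (simp add: x)
  then have "word_act free_act (inv_word v @ u @ v) y = y" for y
    using word_act_free_act_reduce[of "inv_word v @ u @ v" y] by (simp add: e_def Rep_Abs_free_word)
  from this[of "word_act free_act (inv_word v) e"]
  have "word_act free_act u e = e"
    by (simp add: word_act_inj[of free_act, OF bij_free_act])
  then have "Abs_free_word u = Abs_free_word []"
    using word_act_free_act_Nil[OF assms(1)] by (simp add: e_def)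
  then show ?thesis
    using assms(1) by (metis Rep_Abs_free_word reduced_word_simps(1))
qed

section \<open>Indices along free orbits and twisted products\<close>

lemma exists_shift_index:
  fixes p :: "'x \<Rightarrow> 'x"
  assumes inj: "inj p" and free: "\<And>k x. k > 0 \<Longrightarrow> (p ^^ k) x \<noteq> x"
  shows "\<exists>idx :: 'x \<Rightarrow> int. \<forall>x. idx (p x) = idx x + 1"
proof -
  have pow_inj: "(p ^^ i) x = (p ^^ j) x \<Longrightarrow> i = j" for i j x
  proof (induction i j rule: linorder_wlog)
    case (le i j)
    then have "(p ^^ i) x = (p ^^ i) ((p ^^ (j - i)) x)"
      by (metis funpow_add le_add_diff_inverse o_apply)
    then have "(p ^^ (j - i)) x = x"
      using inj_fn[OF inj, of i] by (metis injD)
    then show ?case using free le by (metis le_antisym not_gr_zero diff_is_0_eq)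
  qed simp
  \<comment> \<open>\<open>K x\<close> holds the points whose forward iterates meet those of
    \<open>x\<close>. With a base point \<open>r x\<close> chosen in it, the index is the signed
    number of steps from \<open>r x\<close> to \<open>x\<close>.\<close>
  define K where "K x = {y. \<exists>m n. (p ^^ m) x = (p ^^ n) y}" for x
  define r where "r x = (SOME y. y \<in> K x)" for x
  have K_p: "K (p x) = K x" for x
  proof -
    have "y \<in> K (p x)" if "(p ^^ m) x = (p ^^ n) y" for y m n
      using arg_cong[OF that, of p] unfolding K_def
      by (metis (mono_tags, lifting) funpow.simps(2) funpow_swap1 mem_Collect_eq o_apply)
    moreover have "y \<in> K x" if "(p ^^ m) (p x) = (p ^^ n) y" for y m n
      using that unfolding K_def by (metis (mono_tags, lifting) funpow_Suc_right mem_Collect_eq o_apply)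
    ultimately show ?thesis by (auto simp: K_def)
  qed
  have "\<exists>m n. (p ^^ m) x = (p ^^ n) (r x)" for x
  proof -
    have "x \<in> K x" by (auto simp: K_def)
    then have "r x \<in> K x" unfolding r_def by (rule someI)
    then show ?thesis by (simp add: K_def)
  qed
  then obtain m n where mn: "\<And>x. (p ^^ m x) x = (p ^^ n x) (r x)"
    by metis
  have "int (n (p x)) - int (m (p x)) = int (n x) - int (m x) + 1" for x
  proof -
    have r_p: "r (p x) = r x" by (simp add: r_def K_p)
    have comm: "(p ^^ i) ((p ^^ j) y) = (p ^^ (i + j)) y" for i j y
      by (simp add: funpow_add)
    \<comment> \<open>Two ways of reaching one common iterate from the base point; without periodic
      points their exponents agree.\<close>
    have "(p ^^ (m x + n (p x))) (r x) = (p ^^ m x) ((p ^^ m (p x)) (p x))"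
      using mn[of "p x"] by (simp add: r_p comm)
    also have "\<dots> = (p ^^ (m (p x) + 1)) ((p ^^ m x) x)"
      by (simp add: comm add.commute funpow_swap1)
    also have "\<dots> = (p ^^ (m (p x) + 1 + n x)) (r x)"
      unfolding mn by (rule comm)
    finally have "m x + n (p x) = m (p x) + 1 + n x"
      by (rule pow_inj)
    then show ?thesis by linarith
  qed
  then show ?thesis by (intro exI[of _ "\<lambda>x. int (n x) - int (m x)"]) simp
qed

definition int_iter :: "('x \<Rightarrow> 'x) \<Rightarrow> int \<Rightarrow> 'x \<Rightarrow> 'x" where
  "int_iter p k = (if k \<ge> 0 then p ^^ nat k else inv_into UNIV p ^^ nat (- k))"

lemma int_iter_0 [simp]: "int_iter p 0 x = x"
  and int_iter_1 [simp]: "int_iter p 1 x = p x"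
  by (simp_all add: int_iter_def)

lemma int_iter_step:
  assumes "bij p"
  shows "int_iter p (k + 1) x = p (int_iter p k x)"
proof -
  have [simp]: "p (inv_into UNIV p y) = y" for y
    using assms by (simp add: bij_is_surj surj_f_inv_f)
  consider "k \<ge> 0" | "k = -1" | "k < -1" by linarith
  then show ?thesis
  proof cases
    case 1
    then show ?thesis by (simp add: int_iter_def nat_add_distrib)
  next
    case 2
    then show ?thesis by (simp add: int_iter_def)
  next
    case 3
    then have "nat (- k) = Suc (nat (- (k + 1)))" by simp
    with 3 show ?thesis by (simp add: int_iter_def)
  qed
qed

lemma int_iter_add:
  assumes "bij p"
  shows "int_iter p (i + j) x = int_iter p i (int_iter p j x)"
proof (induction i rule: int_induct[where k = 0])
  case (step1 i)
  then show ?case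
    using int_iter_step[OF assms, of "i + j"] int_iter_step[OF assms, of i] by (simp add: algebra_simps)
next
  case (step2 i)
  have "p (int_iter p (i - 1 + j) x) = p (int_iter p (i - 1) (int_iter p j x))"
    using int_iter_step[OF assms, of "i - 1 + j"] int_iter_step[OF assms, of "i - 1"] step2
    by (simp add: algebra_simps)
  then show ?case using assms by (metis bij_is_inj injD)
qed simp

text \<open>The second coordinate is moved by a coboundary, so that this is an action again; an element
  that raises the index by one, as the first amalgamated word does, acts on the second coordinate
  as the given permutation.\<close>

definition twist_act :: "('g \<Rightarrow> 'x \<Rightarrow> 'x) \<Rightarrow> ('x \<Rightarrow> int) \<Rightarrow> ('y \<Rightarrow> 'y) \<Rightarrow> 'g \<Rightarrow> 'x \<times> 'y \<Rightarrow> 'x \<times> 'y" where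
  "twist_act \<sigma> idx q s = (\<lambda>(x, y). (\<sigma> s x, int_iter q (idx (\<sigma> s x) - idx x) y))"

context
  fixes \<sigma> :: "'g \<Rightarrow> 'x \<Rightarrow> 'x" and q :: "'y \<Rightarrow> 'y" and idx :: "'x \<Rightarrow> int"
  assumes \<sigma>: "\<And>s. bij (\<sigma> s)" and q: "bij q"
begin

lemma twist_act_inverse:
  "bij (twist_act \<sigma> idx q s)"
  "inv_into UNIV (twist_act \<sigma> idx q s) (x, y) =
    (inv_into UNIV (\<sigma> s) x, int_iter q (idx (inv_into UNIV (\<sigma> s) x) - idx x) y)"
proof -
  define f where "f = (\<lambda>(x, y). (inv_into UNIV (\<sigma> s) x, int_iter q (idx (inv_into UNIV (\<sigma> s) x) - idx x) y))"
  have "f (twist_act \<sigma> idx q s z) = z" "twist_act \<sigma> idx q s (f z) = z" for z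
    using \<sigma>[of s] by (auto simp: f_def twist_act_def bij_is_inj bij_is_surj surj_f_inv_f
        int_iter_add[OF q, symmetric] split: prod.split)
  then have "bij (twist_act \<sigma> idx q s)" "inv_into UNIV (twist_act \<sigma> idx q s) z = f z" for z
    by (rule two_sided_inverse)+
  from this(1) this(2)[of "(x, y)"] show "bij (twist_act \<sigma> idx q s)"
    "inv_into UNIV (twist_act \<sigma> idx q s) (x, y) =
      (inv_into UNIV (\<sigma> s) x, int_iter q (idx (inv_into UNIV (\<sigma> s) x) - idx x) y)"
    by (simp_all add: f_def)
qed

text \<open>The index differences telescope along the word, so the power of \<open>q\<close> depends
  only on the two end points.\<close>

lemma word_act_twist_act:
  "word_act (twist_act \<sigma> idx q) w (x, y) = (word_act \<sigma> w x, int_iter q (idx (word_act \<sigma> w x) - idx x) y)"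
proof (induction w)
  case (Cons l w)
  have "letter_act (twist_act \<sigma> idx q) l (a, b) = (letter_act \<sigma> l a, int_iter q (idx (letter_act \<sigma> l a) - idx a) b)" for a b
    by (auto simp: letter_act_def twist_act_inverse(2)) (simp_all add: twist_act_def)
  then show ?case
    using Cons by (simp add: int_iter_add[OF q, symmetric])
qed simp

end

lemma word_act_relator:
  assumes "\<And>s. bij (\<rho> s)" and "\<And>x. word_act \<rho> u x = word_act \<rho> v x"
  shows "word_act \<rho> (u @ inv_word v) x = x"
  using word_act_cancel(2)[of \<rho>, OF assms(1)] assms(2) by simp

text \<open>Positive powers of \<open>w\<close> are again nonempty reduced words, so by
  \<open>free_act_free\<close> the action of \<open>w\<close> has no periodic points.\<close>

lemma exists_index_free_act:
  assumes "cyclically_reduced w" "w \<noteq> []"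
  shows "\<exists>idx. \<forall>x. idx (word_act free_act w x) = idx x + (1 :: int)"
proof (rule exists_shift_index)
  show "inj (word_act free_act w)"
    using bij_word_act[of free_act, OF bij_free_act] by (rule bij_is_inj)
  fix k :: nat and x assume "k > 0"
  then have "concat (replicate k w) \<noteq> []" using assms(2) by simp
  then show "(word_act free_act w ^^ k) x \<noteq> x"
    using free_act_free[OF reduced_concat_replicate[OF assms(1)]]
    unfolding word_act_concat_replicate[symmetric] by metis
qed

text \<open>The amalgam acts on pairs of reduced words so that the first factor moves the first
  coordinate by left multiplication; there \<open>v\<close> moves the empty word.\<close>

lemma reduced_word_not_trivial_in_amalgam:
  assumes w1: "cyclically_reduced w1" "w1 \<noteq> []" and w2: "cyclically_reduced w2" "w2 \<noteq> []"
    and v: "reduced_word v" "v \<noteq> []"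
  shows "word_class S {map (apfst Inl) w1 @ inv_word (map (apfst Inr) w2)} (map (apfst Inl) v)
    \<noteq> word_class S {map (apfst Inl) w1 @ inv_word (map (apfst Inr) w2)} []"
proof
  define r where "r = map (apfst Inl) w1 @ inv_word (map (apfst Inr) w2)"
  assume "word_class S {map (apfst Inl) w1 @ inv_word (map (apfst Inr) w2)} (map (apfst Inl) v)
    = word_class S {map (apfst Inl) w1 @ inv_word (map (apfst Inr) w2)} []"
  then have eq: "(map (apfst Inl) v, []) \<in> pres_equiv S {r}"
    by (simp add: word_class_eq_iff r_def)
  obtain idx1 idx2 where idx: "\<And>x. idx1 (word_act free_act w1 x) = idx1 x + (1 :: int)"
    "\<And>x. idx2 (word_act free_act w2 x) = idx2 x + (1 :: int)"
    using exists_index_free_act w1 w2 by metis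
  define p where "p = word_act free_act w1"
  define q where "q = word_act free_act w2"
  have bij: "bij p" "bij q"
    unfolding p_def q_def by (rule bij_word_act, rule bij_free_act)+
  define t1 where "t1 = twist_act free_act idx1 q"
  \<comment> \<open>The mirror image of \<open>t1\<close>: the second factor translates the second
    coordinate and moves the first one by powers of \<open>p\<close>.\<close>
  define t2 where "t2 s = prod.swap \<circ> twist_act free_act idx2 p s \<circ> prod.swap" for s
  have bij_t: "bij (t1 s)" "bij (t2 s')" for s s'
    unfolding t1_def t2_def
    by (intro bij_conj twist_act_inverse(1) bij_free_act bij swap_swap)+
  define \<rho> where "\<rho> = case_sum t1 t2"
  have bij_\<rho>: "bij (\<rho> s)" for s
    using bij_t by (cases s) (auto simp: \<rho>_def)
  have act1: "word_act \<rho> (map (apfst Inl) u) (x, y) =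
      (word_act free_act u x, int_iter q (idx1 (word_act free_act u x) - idx1 x) y)" for u x y
    by (simp add: word_act_map_apfst \<rho>_def t1_def word_act_twist_act bij_free_act bij)
  have act2: "word_act \<rho> (map (apfst Inr) u) (x, y) =
      (int_iter p (idx2 (word_act free_act u y) - idx2 y) x, word_act free_act u y)" for u x y
  proof -
    have "word_act \<rho> (map (apfst Inr) u) (x, y) = word_act t2 u (x, y)"
      by (simp add: word_act_map_apfst \<rho>_def)
    also have "\<dots> = prod.swap (word_act (twist_act free_act idx2 p) u (prod.swap (x, y)))"
      unfolding t2_def by (rule word_act_conj) (auto intro: twist_act_inverse(1) bij_free_act bij)
    finally show ?thesis
      by (simp add: word_act_twist_act bij_free_act bij)
  qed
  \<comment> \<open>Each word raises its own index by one, so both sides apply \<open>p\<close> to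
    the first and \<open>q\<close> to the second coordinate.\<close>
  have "word_act \<rho> (map (apfst Inl) w1) z = word_act \<rho> (map (apfst Inr) w2) z" for z
    by (cases z) (simp add: act1 act2 idx p_def q_def)
  then have "word_act \<rho> r z = z" for z
    unfolding r_def using word_act_relator[of \<rho>, OF bij_\<rho>] by blast
  then have "word_act \<rho> (map (apfst Inl) v) (Abs_free_word [], Abs_free_word []) = (Abs_free_word [], Abs_free_word [])"
    using word_act_pres_equiv[OF bij_\<rho> _ eq] by simp
  then have "word_act free_act v (Abs_free_word []) = Abs_free_word []"
    by (simp add: act1)
  then show False
    using free_act_free[OF v(1)] v(2) by blast
qed

section \<open>Elements without common conjugate powers\<close>

definition word_pow :: "'g letter list \<Rightarrow> int \<Rightarrow> 'g letter list" where
  "word_pow w k = (if k \<ge> 0 then concat (replicate (nat k) w) else concat (replicate (nat (- k)) (inv_word w)))"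

lemma concat_replicate_lists: "w \<in> lists A \<Longrightarrow> concat (replicate k w) \<in> lists A"
  by (induction k) auto

lemma word_pow_lists: "w \<in> lists (S \<times> UNIV) \<Longrightarrow> word_pow w k \<in> lists (S \<times> UNIV)"
  by (simp add: word_pow_def concat_replicate_lists)

lemma map_concat_replicate: "map f (concat (replicate k w)) = concat (replicate k (map f w))"
  by (simp add: map_concat)

lemma map_apfst_word_pow: "map (apfst f) (word_pow w k) = word_pow (map (apfst f) w) k"
  by (simp add: word_pow_def map_concat_replicate inv_word_map_apfst)

lemma word_class_word_pow:
  assumes "w \<in> lists (S \<times> UNIV)"
  shows "word_class S R (word_pow w k) = word_class S R w [^]\<^bsub>presented_group S R\<^esub> k"
proof -
  interpret group "presented_group S R" by (rule presented_group_group)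
  have "word_class S R (concat (replicate i (inv_word w))) = inv\<^bsub>presented_group S R\<^esub> (word_class S R w [^]\<^bsub>presented_group S R\<^esub> i)" for i :: nat
    using assms by (simp add: presented_group_pow[symmetric] presented_group_inv[symmetric] nat_pow_inv word_class_carrier)
  note neg = this
  show ?thesis
  proof (cases "k \<ge> 0")
    case True
    then have "k = int (nat k)" by simp
    then show ?thesis
      using True presented_group_pow[OF assms, of R "nat k"] int_pow_int[of _ _ "nat k"]
      unfolding word_pow_def by metis
  next
    case False
    then have "k = - int (nat (- k))" by simp
    then have "word_class S R w [^]\<^bsub>presented_group S R\<^esub> k
        = inv\<^bsub>presented_group S R\<^esub> (word_class S R w [^]\<^bsub>presented_group S R\<^esub> nat (- k))"
      using int_pow_neg[OF word_class_carrier[OF assms]] int_pow_int by metis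
    with False neg[of "nat (- k)"] show ?thesis
      unfolding word_pow_def by simp
  qed
qed

text \<open>The sign of \<open>k\<close> is left open, hence two candidates for each end letter;
  \<open>h\<close> is later chosen to avoid cancellation with either.\<close>

lemma word_pow_ends:
  assumes w: "cyclically_reduced w" "w \<noteq> []" and "k \<noteq> 0"
  shows "word_pow w k \<noteq> []" "reduced_word (word_pow w k)"
    "hd (word_pow w k) \<in> {hd w, inv_letter (last w)}" "last (word_pow w k) \<in> {last w, inv_letter (hd w)}"
proof -
  consider "k > 0" | "k < 0" using assms(3) by linarith
  then have "word_pow w k \<noteq> [] \<and> reduced_word (word_pow w k) \<and>
    hd (word_pow w k) \<in> {hd w, inv_letter (last w)} \<and> last (word_pow w k) \<in> {last w, inv_letter (hd w)}"
  proof cases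
    case 1
    then show ?thesis
      using w by (simp add: word_pow_def hd_concat_replicate last_concat_replicate reduced_concat_replicate)
  next
    case 2
    then show ?thesis
      using w by (simp add: word_pow_def hd_concat_replicate last_concat_replicate reduced_concat_replicate
          cyclically_reduced_inv_word hd_inv_word last_inv_word)
  qed
  then show "word_pow w k \<noteq> []" "reduced_word (word_pow w k)"
    "hd (word_pow w k) \<in> {hd w, inv_letter (last w)}" "last (word_pow w k) \<in> {last w, inv_letter (hd w)}"
    by blast+
qed

text \<open>The end letters are chosen so that nothing cancels in \<open>h\<^sup>D w\<^sup>i h\<^sup>-\<^sup>D w\<^sup>-\<^sup>j\<close>.\<close>

lemma exists_noncancelling_word:
  assumes w: "cyclically_reduced w" "w \<noteq> []" "w \<in> lists (S \<times> UNIV)"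
    and S: "a \<in> S" "b \<in> S" "a \<noteq> b"
  obtains h where "cyclically_reduced h" "h \<noteq> []" "h \<in> lists (S \<times> UNIV)"
    "hd h \<noteq> hd w" "hd h \<noteq> inv_letter (last w)" "last h \<noteq> last w" "last h \<noteq> inv_letter (hd w)"
proof (cases "hd w = last w")
  case True
  \<comment> \<open>Both ends of \<open>w\<close> are the same letter, so one letter over another
    generator meets all conditions.\<close>
  obtain s where "s \<in> S" "s \<noteq> fst (hd w)" using S by metis
  then have "(s, False) \<noteq> hd w" "(s, False) \<noteq> inv_letter (hd w)" "(s, False) \<in> S \<times> UNIV"
    by (auto simp: inv_letter_def prod_eq_iff)
  then show thesis
    using that[of "[(s, False)]"] True by (simp add: cyclically_reduced_def)
next
  case False
  \<comment> \<open>The word \<open>[last w, hd w]\<close> serves here: the case assumption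
    separates its ends from those of \<open>w\<close>, and cyclic reducedness of \<open>w\<close>
    prevents cancellation.\<close>
  have ne: "last w \<noteq> inv_letter (hd w)"
    using w by (simp add: cyclically_reduced_def)
  then have ne': "hd w \<noteq> inv_letter (last w)"
    by (metis inv_letter_inv_letter)
  have "hd w \<in> S \<times> UNIV" "last w \<in> S \<times> UNIV"
    using w(2,3) by (simp_all add: in_lists_conv_set)
  then show thesis
    using that[of "[last w, hd w]"] False ne ne' by (simp add: cyclically_reduced_def)
qed

text \<open>Only the three junctions can cancel. The conditions on \<open>last h\<close> settle the
  two around \<open>word_pow w i\<close>, those on \<open>hd h\<close> the last one.\<close>

lemma reduced_commutator_word:
  assumes w: "cyclically_reduced w" "w \<noteq> []" and h: "cyclically_reduced h" "h \<noteq> []"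
    and ends: "hd h \<noteq> hd w" "hd h \<noteq> inv_letter (last w)" "last h \<noteq> last w" "last h \<noteq> inv_letter (hd w)"
    and "D > 0" "i \<noteq> 0" "j \<noteq> 0"
  shows "reduced_word (word_pow h (int D) @ word_pow w i @ word_pow h (- int D) @ word_pow w j)"
proof -
  have hD: "hd (word_pow h (- int D)) = inv_letter (last h)" "last (word_pow h (int D)) = last h"
    "last (word_pow h (- int D)) = inv_letter (hd h)"
    using \<open>D > 0\<close> h(2) by (simp_all add: word_pow_def hd_concat_replicate last_concat_replicate hd_inv_word last_inv_word)
  note wi = word_pow_ends[OF w \<open>i \<noteq> 0\<close>] and wj = word_pow_ends[OF w \<open>j \<noteq> 0\<close>]
  note hp = word_pow_ends[OF h, of "int D"] and hm = word_pow_ends[OF h, of "- int D"]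
  have "hd (word_pow w i) \<noteq> inv_letter (last h)"
    using wi(3) ends by (metis insertE inv_letter_inv_letter singletonD)
  moreover have "inv_letter (last h) \<noteq> inv_letter (last (word_pow w i))"
    using wi(4) ends by (metis insertE inv_letter_inv_letter singletonD)
  moreover have "hd (word_pow w j) \<noteq> hd h"
    using wj(3) ends by (metis insertE singletonD)
  ultimately show ?thesis
    using wi(1,2) wj(1,2) hp(1,2) hm(1,2) hD \<open>D > 0\<close> by (simp add: reduced_word_append)
qed

context group
begin

text \<open>Two exceptions \<open>N\<close> and \<open>N + D\<close> would give a forbidden relation
  between \<open>h [^] D\<close> and powers of \<open>w\<close>, so each set has at most one member.
  For cosets of the powers of \<open>w\<close>, the first set says that \<open>g\<close> carries the
  coset of \<open>h [^] N\<close> to the base coset, the second that \<open>g\<close> fixes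
  it.\<close>

lemma finite_exceptions:
  assumes h: "h \<in> carrier G" and w: "w \<in> carrier G"
    and conj: "\<And>D (i :: int) (j :: int). \<lbrakk>D > (0 :: nat); i \<noteq> 0; j \<noteq> 0\<rbrakk> \<Longrightarrow> h [^] D \<otimes> w [^] i \<noteq> w [^] j \<otimes> h [^] D"
    and g: "g \<in> carrier G"
  shows "finite {N :: nat. \<exists>k :: int. g \<otimes> h [^] N = w [^] k}"
    and "g \<noteq> \<one> \<Longrightarrow> finite {N :: nat. \<exists>k :: int. g \<otimes> h [^] N = h [^] N \<otimes> w [^] k}"
proof -
  have at_most_one: "finite A" if "\<And>N D. \<lbrakk>N \<in> A; N + D \<in> A; D > 0\<rbrakk> \<Longrightarrow> False" for A :: "nat set"
  proof (cases "A = {}")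
    case False
    then obtain N where "N \<in> A" by blast
    have "M = N" if "M \<in> A" for M
    proof (rule linorder_cases[of M N])
      assume "M < N"
      then show ?thesis using \<open>\<And>N D. \<lbrakk>N \<in> A; N + D \<in> A; D > 0\<rbrakk> \<Longrightarrow> False\<close>[of M "N - M"] \<open>N \<in> A\<close> \<open>M \<in> A\<close> by simp
    next
      assume "N < M"
      then show ?thesis using \<open>\<And>N D. \<lbrakk>N \<in> A; N + D \<in> A; D > 0\<rbrakk> \<Longrightarrow> False\<close>[of N "M - N"] \<open>N \<in> A\<close> \<open>M \<in> A\<close> by simp
    qed
    then have "A \<subseteq> {N}" by blast
    then show ?thesis by (rule finite_subset) simp
  qed simp
  note [simp] = h w g
  show "finite {N :: nat. \<exists>k :: int. g \<otimes> h [^] N = w [^] k}"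
  proof (rule at_most_one, clarify)
    fix N D :: nat and i j :: int
    assume ij: "g \<otimes> h [^] N = w [^] i" "g \<otimes> h [^] (N + D) = w [^] j" and D: "D > 0"
    have "w [^] i \<otimes> h [^] D = w [^] j"
      using ij by (simp add: nat_pow_mult[symmetric] m_assoc[symmetric])
    also have "\<dots> = w [^] i \<otimes> w [^] (j - i)"
      by (simp add: int_pow_mult[symmetric])
    \<comment> \<open>A power of \<open>w\<close> commutes with \<open>w\<close>, against
      \<open>conj\<close> for exponents 1 and 1.\<close>
    finally have "h [^] D = w [^] (j - i)"
      by simp
    then have "h [^] D \<otimes> w [^] (1 :: int) = w [^] (1 :: int) \<otimes> h [^] D"
      by (metis add.commute int_pow_mult w)
    then show False using conj[OF D, of 1 1] by simp
  qed
  assume "g \<noteq> \<one>"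
  show "finite {N :: nat. \<exists>k :: int. g \<otimes> h [^] N = h [^] N \<otimes> w [^] k}"
  proof (rule at_most_one, clarify)
    fix N D :: nat and i j :: int
    assume i: "g \<otimes> h [^] N = h [^] N \<otimes> w [^] i" and j: "g \<otimes> h [^] (N + D) = h [^] (N + D) \<otimes> w [^] j" and D: "D > 0"
    \<comment> \<open>A zero exponent would force \<open>g\<close> to be trivial; so
      \<open>conj\<close> applies to \<open>i\<close> and \<open>j\<close>.\<close>
    have nz: "k \<noteq> 0" if "g \<otimes> h [^] M = h [^] M \<otimes> w [^] k" for M :: nat and k :: int
      using that \<open>g \<noteq> \<one>\<close> by (auto)
    have "h [^] N \<otimes> (w [^] i \<otimes> h [^] D) = g \<otimes> h [^] N \<otimes> h [^] D"
      by (simp add: i m_assoc)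
    also have "\<dots> = h [^] N \<otimes> (h [^] D \<otimes> w [^] j)"
      using j by (simp add: nat_pow_mult[symmetric] m_assoc)
    finally have "h [^] D \<otimes> w [^] j = w [^] i \<otimes> h [^] D"
      by simp
    then show False using conj[OF D] nz[OF i] nz[OF j] by blast
  qed
qed

end

text \<open>Brought to one side, such an equation makes the commutator-like word \<open>c\<close>
  trivial in the amalgam, although it is a nonempty reduced word in the first factor.\<close>

lemma amalgam_no_conjugate_powers:
  fixes w1 :: "'a letter list" and w2 :: "'b letter list"
  defines "r \<equiv> map (apfst Inl) w1 @ inv_word (map (apfst Inr) w2)"
  assumes w1: "cyclically_reduced w1" "w1 \<noteq> []" and w2: "cyclically_reduced w2" "w2 \<noteq> []"
    and lists: "map (apfst Inl) w1 \<in> lists (S \<times> UNIV)" "map (apfst Inl) h \<in> lists (S \<times> UNIV)"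
    and h: "cyclically_reduced h" "h \<noteq> []"
      "hd h \<noteq> hd w1" "hd h \<noteq> inv_letter (last w1)" "last h \<noteq> last w1" "last h \<noteq> inv_letter (hd w1)"
    and D: "D > (0 :: nat)" and ij: "i \<noteq> (0 :: int)" "j \<noteq> (0 :: int)"
  shows "word_class S {r} (map (apfst Inl) h) [^]\<^bsub>presented_group S {r}\<^esub> D \<otimes>\<^bsub>presented_group S {r}\<^esub>
      word_class S {r} (map (apfst Inl) w1) [^]\<^bsub>presented_group S {r}\<^esub> i \<noteq>
    word_class S {r} (map (apfst Inl) w1) [^]\<^bsub>presented_group S {r}\<^esub> j \<otimes>\<^bsub>presented_group S {r}\<^esub>
      word_class S {r} (map (apfst Inl) h) [^]\<^bsub>presented_group S {r}\<^esub> D"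
    (is "?h [^]\<^bsub>?G\<^esub> D \<otimes>\<^bsub>?G\<^esub> ?w [^]\<^bsub>?G\<^esub> i \<noteq> _")
proof
  interpret group ?G by (rule presented_group_group)
  define c where "c = word_pow h (int D) @ word_pow w1 i @ word_pow h (- int D) @ word_pow w1 (- j)"
  have car: "?h \<in> carrier ?G" "?w \<in> carrier ?G"
    using lists by (simp_all add: word_class_carrier)
  assume eq: "?h [^]\<^bsub>?G\<^esub> D \<otimes>\<^bsub>?G\<^esub> ?w [^]\<^bsub>?G\<^esub> i = ?w [^]\<^bsub>?G\<^esub> j \<otimes>\<^bsub>?G\<^esub> ?h [^]\<^bsub>?G\<^esub> D"
  have "word_class S {r} (map (apfst Inl) c) = ?h [^]\<^bsub>?G\<^esub> (int D) \<otimes>\<^bsub>?G\<^esub>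
      (?w [^]\<^bsub>?G\<^esub> i \<otimes>\<^bsub>?G\<^esub> (?h [^]\<^bsub>?G\<^esub> (- int D) \<otimes>\<^bsub>?G\<^esub> ?w [^]\<^bsub>?G\<^esub> (- j)))"
    using lists by (simp add: c_def map_apfst_word_pow presented_group_mult[symmetric] word_pow_lists
        word_class_word_pow del: map_append) (simp add: map_apfst_word_pow presented_group_mult[symmetric] word_pow_lists
        word_class_word_pow)
  also have "\<dots> = (?h [^]\<^bsub>?G\<^esub> D \<otimes>\<^bsub>?G\<^esub> ?w [^]\<^bsub>?G\<^esub> i) \<otimes>\<^bsub>?G\<^esub> (inv\<^bsub>?G\<^esub> (?h [^]\<^bsub>?G\<^esub> D) \<otimes>\<^bsub>?G\<^esub> inv\<^bsub>?G\<^esub> (?w [^]\<^bsub>?G\<^esub> j))"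
    using car by (simp add: m_assoc int_pow_neg int_pow_int)
  also have "\<dots> = (?w [^]\<^bsub>?G\<^esub> j \<otimes>\<^bsub>?G\<^esub> ?h [^]\<^bsub>?G\<^esub> D) \<otimes>\<^bsub>?G\<^esub> inv\<^bsub>?G\<^esub> (?w [^]\<^bsub>?G\<^esub> j \<otimes>\<^bsub>?G\<^esub> ?h [^]\<^bsub>?G\<^esub> D)"
    using car by (simp add: eq inv_mult_group)
  also have "\<dots> = \<one>\<^bsub>?G\<^esub>"
    using car by (intro r_inv) simp
  finally have "word_class S {r} (map (apfst Inl) c) = word_class S {r} []"
    by (simp add: presented_group_one)
  moreover have "reduced_word c" "c \<noteq> []"
    using reduced_commutator_word[OF w1 h D ij(1), of "- j"] ij word_pow_ends(1)[OF w1 ij(1)] by (simp_all add: c_def)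
  ultimately show False
    using reduced_word_not_trivial_in_amalgam[OF w1 w2] unfolding r_def by blast
qed

section \<open>Surgery at two fixed points\<close>

definition word_weight :: "('g \<Rightarrow> int) \<Rightarrow> 'g letter list \<Rightarrow> int" where
  "word_weight c w = (\<Sum>l\<leftarrow>w. if snd l then - c (fst l) else c (fst l))"

lemma word_weight_simps [simp]:
  "word_weight c [] = 0"
  "word_weight c (l # w) = (if snd l then - c (fst l) else c (fst l)) + word_weight c w"
  "word_weight c (u @ v) = word_weight c u + word_weight c v"
  by (simp_all add: word_weight_def)

lemma word_weight_inv_word [simp]: "word_weight c (inv_word w) = - word_weight c w"
  by (induction w) (auto simp: inv_letter_def)

lemma word_weight_concat_replicate: "word_weight c (concat (replicate k w)) = int k * word_weight c w"
  by (induction k) (auto simp: algebra_simps)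

lemma word_weight_word_pow [simp]: "word_weight c (word_pow w k) = k * word_weight c w"
  by (simp add: word_pow_def word_weight_concat_replicate)

lemma word_weight_map_apfst [simp]: "word_weight c (map (apfst f) w) = word_weight (\<lambda>s. c (f s)) w"
  by (induction w) auto

lemma word_weight_combination:
  "word_weight (\<lambda>s. a * c s + b * d s) w = a * word_weight c w + b * word_weight d w"
  by (induction w) (auto simp: algebra_simps)

text \<open>If \<open>e\<close> and \<open>f\<close> are the exponent sums of \<open>s\<close> and
  \<open>t\<close> in \<open>w\<close>, then weights f/gcd on \<open>s\<close> and -e/gcd on
  \<open>t\<close> kill \<open>w\<close>. They are coprime, so Bezout exponents give a word of
  weight one. If both sums vanish, counting \<open>s\<close> suffices.\<close>

lemma exists_killing_weight:
  assumes S: "s \<in> S" "t \<in> S" "s \<noteq> t"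
  shows "\<exists>c z. word_weight c w = 0 \<and> z \<in> lists (S \<times> UNIV) \<and> word_weight c z = 1"
proof -
  define d where "d s = (\<lambda>x. of_bool (x = s) :: int)" for s :: 'a
  define e f where "e = word_weight (d s) w" and "f = word_weight (d t) w"
  show ?thesis
  proof (cases "e = 0 \<and> f = 0")
    case True
    then show ?thesis
      using S by (intro exI[of _ "d s"] exI[of _ "[(s, False)]"]) (simp add: e_def d_def)
  next
    case False
    define a b where "a = f div gcd e f" and "b = - (e div gcd e f)"
    have "coprime a b"
      using False by (simp add: a_def b_def div_gcd_coprime coprime_commute)
    then obtain x y where xy: "x * a + y * b = 1"
      using bezout_int[of a b] by auto
    define c where "c = (\<lambda>u. a * d s u + b * d t u)"
    have "word_weight c w = f div gcd e f * e - e div gcd e f * f"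
      unfolding c_def word_weight_combination e_def[symmetric] f_def[symmetric] by (simp add: a_def b_def)
    also have "\<dots> = 0"
      by (simp add: div_mult_swap dvd_div_mult mult.commute)
    finally have "word_weight c w = 0" .
    moreover have "word_weight c (word_pow [(s, False)] x @ word_pow [(t, False)] y) = 1"
      using xy S(3) by (simp add: c_def d_def)
    moreover have "word_pow [(s, False)] x @ word_pow [(t, False)] y \<in> lists (S \<times> UNIV)"
      using S word_pow_lists[of "[(s, False)]" S x] word_pow_lists[of "[(t, False)]" S y] by simp
    ultimately show ?thesis by blast
  qed
qed

lemma map_apfst_lists: "w \<in> lists (A \<times> UNIV) \<Longrightarrow> f ` A \<subseteq> B \<Longrightarrow> map (apfst f) w \<in> lists (B \<times> UNIV)"
  by (induction w) (auto simp: apfst_def map_prod_def)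

text \<open>Sets that are not contained in the carrier are fixed, so that this is an action on the whole type.\<close>

definition translate :: "('a, 'b) monoid_scheme \<Rightarrow> 'a \<Rightarrow> 'a set \<Rightarrow> 'a set" where
  "translate G g C = (if C \<subseteq> carrier G then (\<lambda>x. g \<otimes>\<^bsub>G\<^esub> x) ` C else C)"

context group
begin

lemma translate_one [simp]: "translate G \<one> C = C"
proof (cases "C \<subseteq> carrier G")
  case True
  then have "(\<lambda>x. \<one> \<otimes> x) ` C = id ` C" by (intro image_cong) auto
  with True show ?thesis by (simp add: translate_def)
qed (simp add: translate_def)

lemma translate_mult:
  assumes "g \<in> carrier G" "h \<in> carrier G"
  shows "translate G (g \<otimes> h) C = translate G g (translate G h C)"
proof (cases "C \<subseteq> carrier G")
  case True
  then have "(\<lambda>x. h \<otimes> x) ` C \<subseteq> carrier G"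
    using assms by auto
  moreover have "(\<lambda>x. g \<otimes> h \<otimes> x) ` C = (\<lambda>x. g \<otimes> (h \<otimes> x)) ` C"
    using True assms by (intro image_cong) (auto simp: m_assoc)
  ultimately show ?thesis
    using True by (simp add: translate_def image_image)
qed (simp add: translate_def)

lemma translate_inv [simp]:
  assumes "g \<in> carrier G"
  shows "translate G (inv g) (translate G g C) = C" "translate G g (translate G (inv g) C) = C"
  using assms by (simp_all add: translate_mult[symmetric])

lemma translate_powers:
  assumes "w \<in> carrier G"
  shows "translate G w (range (\<lambda>k :: int. w [^] k)) = range (\<lambda>k :: int. w [^] k)"
proof -
  have "w \<otimes> w [^] k = w [^] (k + 1)" for k :: int
    using assms int_pow_mult[of w 1 k] by (simp add: add.commute)
  then have "translate G w (range (\<lambda>k :: int. w [^] k)) = range (\<lambda>k :: int. w [^] (k + 1))"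
    using assms by (simp add: translate_def image_subset_iff image_image)
  also have "\<dots> = (\<lambda>k. w [^] k) ` range (\<lambda>k :: int. k + 1)"
    by (simp only: image_image)
  also have "range (\<lambda>k :: int. k + 1) = UNIV"
    by (rule surjI[of _ "\<lambda>k. k - 1"]) simp
  finally show ?thesis .
qed

lemma translate_eqD:
  assumes "g \<in> carrier G" "h \<in> carrier G" "w \<in> carrier G"
    and "translate G g (range (\<lambda>k :: int. w [^] k)) = translate G h (range (\<lambda>k :: int. w [^] k))"
  shows "\<exists>k :: int. g = h \<otimes> w [^] k"
proof -
  have sub: "range (\<lambda>k :: int. w [^] k) \<subseteq> carrier G"
    using assms(3) by auto
  have "g \<otimes> w [^] (0 :: int) \<in> translate G g (range (\<lambda>k :: int. w [^] k))"
    unfolding translate_def if_P[OF sub] by (intro imageI rangeI)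
  then have "g \<in> (\<lambda>x. h \<otimes> x) ` range (\<lambda>k :: int. w [^] k)"
    unfolding assms(4) using sub assms(1) by (simp add: translate_def)
  then show ?thesis by blast
qed

end

text \<open>\<open>c\<close> lists the values of the homomorphism to the integers on generators,
  \<open>za\<close> and \<open>zb\<close> witness its surjectivity on the two factors, and powers of
  \<open>h\<close> will supply common moved points.\<close>

locale surgery =
  fixes m n :: nat and w1 w2 h za zb :: "nat letter list" and c :: "nat + nat \<Rightarrow> int"
  assumes w1: "w1 \<in> lists ({..m} \<times> UNIV)" "cyclically_reduced w1" "w1 \<noteq> []"
    and w2: "w2 \<in> lists ({..n} \<times> UNIV)" "cyclically_reduced w2" "w2 \<noteq> []"
    and h: "h \<in> lists ({..m} \<times> UNIV)" "cyclically_reduced h" "h \<noteq> []"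
      "hd h \<noteq> hd w1" "hd h \<noteq> inv_letter (last w1)" "last h \<noteq> last w1" "last h \<noteq> inv_letter (hd w1)"
    and za: "za \<in> lists ({..m} \<times> UNIV)" "word_weight (\<lambda>i. c (Inl i)) za = 1"
    and zb: "zb \<in> lists ({..n} \<times> UNIV)" "word_weight (\<lambda>j. c (Inr j)) zb = 1"
    and c: "word_weight (\<lambda>i. c (Inl i)) w1 = 0" "word_weight (\<lambda>j. c (Inr j)) w2 = 0"
begin

definition S :: "(nat + nat) set" where "S = Inl ` {..m} \<union> Inr ` {..n}"
definition r where "r = map (apfst Inl) w1 @ inv_word (map (apfst Inr) w2)"

abbreviation G where "G \<equiv> presented_group S {r}"
abbreviation cls where "cls \<equiv> word_class S {r}"

sublocale group G by (rule presented_group_group)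

definition w where "w = cls (map (apfst Inl) w1)"
text \<open>The cyclic subgroup generated by \<open>w\<close>, as base point of its space of left
  cosets.\<close>

definition P where "P = range (\<lambda>k :: int. w [^]\<^bsub>G\<^esub> k)"
text \<open>The default outside \<open>S\<close> makes \<open>base_act s\<close> a bijection for
  every \<open>s\<close> of the type.\<close>

definition g where "g s = (if s \<in> S then cls [(s, False)] else \<one>\<^bsub>G\<^esub>)"

definition base_act where
  "base_act s = map_sum (\<lambda>k. k + c s) (translate G (g s))"

definition swap :: "int + (nat + nat) letter list set set \<Rightarrow> int + (nat + nat) letter list set set" where
  "swap = id(Inl 0 := Inr P, Inr P := Inl 0)"

definition act where
  "act s = (case s of Inl _ \<Rightarrow> base_act s | Inr _ \<Rightarrow> swap \<circ> base_act s \<circ> swap)"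

lemma lists_Inl: "u \<in> lists ({..m} \<times> UNIV) \<Longrightarrow> map (apfst Inl) u \<in> lists (S \<times> UNIV)"
  and lists_Inr: "v \<in> lists ({..n} \<times> UNIV) \<Longrightarrow> map (apfst Inr) v \<in> lists (S \<times> UNIV)"
  by (erule map_apfst_lists, force simp: S_def)+

lemma w_carrier: "w \<in> carrier G"
  unfolding w_def by (intro word_class_carrier lists_Inl w1)

lemma w_eq: "w = cls (map (apfst Inr) w2)"
proof -
  have "cls r = \<one>\<^bsub>G\<^esub>"
    by (rule presented_group_relator) (simp_all add: r_def lists_Inl lists_Inr w1 w2)
  then have "w \<otimes>\<^bsub>G\<^esub> inv\<^bsub>G\<^esub> cls (map (apfst Inr) w2) = \<one>\<^bsub>G\<^esub>"
    by (simp add: w_def r_def presented_group_inv presented_group_mult lists_Inl lists_Inr w1 w2)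
  then show ?thesis
    using inv_equality[of w "inv\<^bsub>G\<^esub> cls (map (apfst Inr) w2)"] w_carrier
      word_class_carrier[OF lists_Inr[OF w2(1)]] by simp
qed

lemma g_carrier: "g s \<in> carrier G"
  by (simp add: g_def word_class_carrier)

lemma base_act_inverse:
  "bij (base_act s)"
  "inv_into UNIV (base_act s) x = map_sum (\<lambda>k. k - c s) (translate G (inv\<^bsub>G\<^esub> (g s))) x"
proof -
  have 1: "map_sum (\<lambda>k. k - c s) (translate G (inv\<^bsub>G\<^esub> (g s))) (base_act s y) = y" for y
    using g_carrier[of s] by (cases y) (auto simp: base_act_def)
  have 2: "base_act s (map_sum (\<lambda>k. k - c s) (translate G (inv\<^bsub>G\<^esub> (g s))) y) = y" for y
    using g_carrier[of s] by (cases y) (auto simp: base_act_def)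
  show "bij (base_act s)"
    "inv_into UNIV (base_act s) x = map_sum (\<lambda>k. k - c s) (translate G (inv\<^bsub>G\<^esub> (g s))) x"
    by (rule two_sided_inverse, rule 1, rule 2)+
qed

lemma word_base_act_Inl: "word_act base_act u (Inl k) = Inl (k + word_weight c u)"
proof (induction u)
  case (Cons l u)
  then show ?case
    by (auto simp: letter_act_def base_act_inverse(2)) (simp add: base_act_def)
qed simp

lemma letter_base_act_Inr:
  assumes "fst l \<in> S"
  shows "letter_act base_act l (Inr C) = Inr (translate G (cls [l]) C)"
proof -
  have "[(fst l, False)] \<in> lists (S \<times> UNIV)"
    using assms by simp
  then have "inv\<^bsub>G\<^esub> (g (fst l)) = cls [(fst l, True)]"
    using assms by (simp add: g_def presented_group_inv inv_letter_def)
  then show ?thesis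
    using assms by (cases l; cases "snd l") (auto simp: letter_act_def base_act_inverse(2), auto simp: base_act_def g_def)
qed

lemma word_base_act_Inr:
  assumes "u \<in> lists (S \<times> UNIV)"
  shows "word_act base_act u (Inr C) = Inr (translate G (cls u) C)"
  using assms
proof (induction u)
  case (Cons l u)
  have l: "[l] \<in> lists (S \<times> UNIV)" "fst l \<in> S"
    using Cons.hyps by auto
  have "translate G (cls [l]) (translate G (cls u) C) = translate G (cls [l] \<otimes>\<^bsub>G\<^esub> cls u) C"
    using l Cons.hyps by (simp add: translate_mult word_class_carrier)
  also have "cls [l] \<otimes>\<^bsub>G\<^esub> cls u = cls (l # u)"
    using presented_group_mult[OF l(1) Cons.hyps(2)] by simp
  finally show ?case
    using Cons.IH letter_base_act_Inr[OF l(2)] by simp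
qed (simp add: presented_group_one[symmetric])

lemma swap_swap [simp]: "swap (swap x) = x"
  by (simp add: swap_def)

lemma swap_simps [simp]: "swap (Inl 0) = Inr P" "swap (Inr P) = Inl 0"
  "k \<noteq> 0 \<Longrightarrow> swap (Inl k) = Inl k" "C \<noteq> P \<Longrightarrow> swap (Inr C) = Inr C"
  by (simp_all add: swap_def)

lemma bij_act: "bij (act s)"
  by (auto simp: act_def base_act_inverse(1) intro: bij_conj split: sum.split)

lemma word_act_Inl: "word_act act (map (apfst Inl) u) x = word_act base_act (map (apfst Inl) u) x"
  by (simp add: word_act_map_apfst act_def)

lemma word_act_Inr: "word_act act (map (apfst Inr) u) x = swap (word_act base_act (map (apfst Inr) u) (swap x))"
  by (simp add: word_act_map_apfst act_def word_act_conj[OF base_act_inverse(1)])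

lemma base_act_w2: "word_act base_act (map (apfst Inr) w2) x = word_act base_act (map (apfst Inl) w1) x"
  by (cases x) (simp_all add: word_base_act_Inl word_base_act_Inr lists_Inl lists_Inr w1 w2 c w_eq[symmetric] w_def[symmetric])

text \<open>Under \<open>base_act\<close>, \<open>w\<close> fixes both \<open>Inl 0\<close> and
  \<open>Inr P\<close>. By injectivity it sends no other point there, so conjugation by
  \<open>swap\<close> does not change its action.\<close>

lemma word_act_r: "word_act act r x = x"
  unfolding r_def
proof (rule word_act_relator[OF bij_act])
  fix x :: "int + (nat + nat) letter list set set"
  let ?f = "word_act base_act (map (apfst Inl) w1)"
  have fix1: "?f (Inl 0) = Inl 0"
    by (simp add: word_base_act_Inl c)
  have fix2: "?f (Inr P) = Inr P"
    using translate_powers[OF w_carrier]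
    by (simp add: word_base_act_Inr lists_Inl w1 w_def[symmetric] P_def)
  have inj: "?f y = ?f z \<longleftrightarrow> y = z" for y z
    by (rule word_act_inj[OF base_act_inverse(1)])
  consider "x = Inl 0" | "x = Inr P" | "x \<noteq> Inl 0" "x \<noteq> Inr P" by blast
  then have "swap (?f (swap x)) = ?f x"
  proof cases
    case 3
    then have "?f x \<noteq> Inl 0" "?f x \<noteq> Inr P"
      using inj[of x "Inl 0"] inj[of x "Inr P"] by (simp_all only: fix1 fix2) simp_all
    with 3 show ?thesis by (simp add: swap_def)
  qed (simp_all only: swap_simps fix1 fix2)
  then show "word_act act (map (apfst Inl) w1) x = word_act act (map (apfst Inr) w2) x"
    by (simp add: word_act_Inl word_act_Inr base_act_w2)
qed

lemma lift_act_cls [simp]: "lift_act act (cls u) x = word_act act u x"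
  by (rule lift_act_word_class) (auto simp: bij_act word_act_r)

lemma carrierE:
  assumes "x \<in> carrier G"
  obtains u where "u \<in> lists (S \<times> UNIV)" "x = cls u"
  using assms unfolding presented_group_carrier by (rule imageE)

sublocale total_action G "lift_act act"
proof unfold_locales
  show "lift_act act \<one>\<^bsub>G\<^esub> x = x" for x
    by (simp add: presented_group_one)
  fix a b x assume "a \<in> carrier G" "b \<in> carrier G"
  then obtain u v where "u \<in> lists (S \<times> UNIV)" "a = cls u" "v \<in> lists (S \<times> UNIV)" "b = cls v"
    by (metis carrierE)
  then show "lift_act act (a \<otimes>\<^bsub>G\<^esub> b) x = lift_act act a (lift_act act b x)"
    by (simp add: presented_group_mult)
qed

section \<open>The orbit of the integer 0\<close>

definition X where "X = (\<lambda>a. lift_act act a (Inl 0)) ` carrier G"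

lemma X_eq: "X = (\<lambda>u. word_act act u (Inl 0)) ` lists (S \<times> UNIV)"
  by (simp add: X_def presented_group_carrier image_image)

lemma X_closed:
  assumes "x \<in> X" "u \<in> lists (S \<times> UNIV)"
  shows "word_act act u x \<in> X"
proof -
  obtain v where v: "v \<in> lists (S \<times> UNIV)" "x = word_act act v (Inl 0)"
    using assms(1) unfolding X_eq by (rule imageE)
  have "word_act act (u @ v) (Inl 0) \<in> X"
    unfolding X_eq using assms(2) v(1) by (intro imageI) simp
  then show ?thesis by (simp add: v(2))
qed

lemma Inl_X: "Inl k \<in> X"
proof -
  have "word_act act (map (apfst Inl) (word_pow za k)) (Inl 0) \<in> X"
    unfolding X_eq by (intro imageI lists_Inl word_pow_lists za)
  then show ?thesis
    by (simp add: word_act_Inl word_base_act_Inl za)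
qed

text \<open>This is where the two spaces are joined: \<open>swap\<close> takes \<open>Inr P\<close>
  to \<open>Inl 0\<close>, \<open>zb\<close> shifts it to \<open>Inl 1\<close>, and
  \<open>swap\<close> leaves that alone. So the inverse of \<open>zb\<close> leads from 1 to the
  base coset.\<close>

lemma Inr_P_X: "Inr P \<in> X"
proof -
  have z: "map (apfst Inr) zb \<in> lists (S \<times> UNIV)"
    by (intro lists_Inr zb)
  have "word_act act (map (apfst Inr) zb) (Inr P) = Inl 1"
    by (simp add: word_act_Inr word_base_act_Inl zb)
  then have "Inr P = word_act act (inv_word (map (apfst Inr) zb)) (Inl 1)"
    using word_act_cancel(1)[of act "map (apfst Inr) zb" "Inr P", OF bij_act] by simp
  also have "\<dots> \<in> X"
    using z by (intro X_closed Inl_X) simp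
  finally show ?thesis .
qed

lemma letter_act_Inl: "fst l = Inl i \<Longrightarrow> letter_act act l x = letter_act base_act l x"
  by (simp add: act_def letter_act_def)

lemma letter_act_Inr: "fst l = Inr j \<Longrightarrow> letter_act act l x = swap (letter_act base_act l (swap x))"
  using word_act_Inr[of "[(j, snd l)]" x] by (cases l) simp

lemma letter_act_Inr_eq:
  assumes "letter_act base_act l (Inr C) = Inr D" "C \<noteq> P" "D \<noteq> P"
  shows "letter_act act l (Inr C) = Inr D"
  using assms by (cases "fst l") (simp_all add: letter_act_Inl letter_act_Inr)

lemma Inr_X:
  assumes "u \<in> lists (S \<times> UNIV)"
  shows "Inr (translate G (cls u) P) \<in> X"
  using assms
proof (induction u)
  case Nil
  then show ?case using Inr_P_X by (simp add: presented_group_one[symmetric])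
next
  case (Cons l u)
  have l: "fst l \<in> S" "[l] \<in> lists (S \<times> UNIV)" using Cons.hyps by auto
  define C where "C = translate G (cls u) P"
  define D where "D = translate G (cls (l # u)) P"
  have CD: "letter_act base_act l (Inr C) = Inr D"
    using word_base_act_Inr[of u P] word_base_act_Inr[of "l # u" P] Cons.hyps by (simp add: C_def D_def)
  have "Inr D \<in> X"
  proof (cases "D = P")
    case False
    have *: "letter_act act l x \<in> X" if "x \<in> X" for x
      using X_closed[OF that l(2)] by simp
    show ?thesis
    proof (cases "fst l")
      case (Inl i)
      then have "letter_act act l (Inr C) = Inr D" using CD by (simp add: letter_act_Inl)
      then show ?thesis using *[of "Inr C"] Cons.IH by (simp add: C_def)
    next
      case (Inr j)
      \<comment> \<open>Starting at \<open>swap (Inr C)\<close> undoes the inner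
        \<open>swap\<close>, and the outer one fixes \<open>Inr D\<close>. If \<open>C\<close> is
        \<open>P\<close>, the starting point is \<open>Inl 0\<close>, again in the orbit.\<close>
      have "letter_act act l (swap (Inr C)) = swap (letter_act base_act l (Inr C))"
        by (simp add: letter_act_Inr[OF Inr])
      also have "\<dots> = Inr D"
        using CD False by simp
      finally have "Inr D = letter_act act l (swap (Inr C))" by simp
      moreover have "swap (Inr C) \<in> X"
        using Cons.IH Inl_X by (cases "C = P") (auto simp: C_def)
      ultimately show ?thesis using * by simp
    qed
  qed (simp add: Inr_P_X)
  then show ?case by (simp add: D_def)
qed

text \<open>Words act from the right, so the suffixes \<open>drop k u\<close> give the successive
  positions of the coset. As long as these avoid \<open>P\<close>, \<open>swap\<close> has no
  effect.\<close>

lemma word_act_Inr_away: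
  assumes "u \<in> lists (S \<times> UNIV)" and "\<And>k. translate G (cls (drop k u)) C \<noteq> P"
  shows "word_act act u (Inr C) = Inr (translate G (cls u) C)"
  using assms
proof (induction u)
  case (Cons l u)
  have "translate G (cls (drop k u)) C \<noteq> P" for k
    using Cons.prems(1)[of "Suc k"] by simp
  moreover have "letter_act base_act l (Inr (translate G (cls u) C)) = Inr (translate G (cls (l # u)) C)"
    using word_base_act_Inr[of u C] word_base_act_Inr[of "l # u" C] Cons.hyps by simp
  ultimately show ?case
    using Cons.IH letter_act_Inr_eq Cons.prems(1)[of 0] by (metis drop0 word_act_simps(2))
qed (simp add: presented_group_one[symmetric])

lemma free_points:
  assumes "finite F" "F \<subseteq> carrier G - {\<one>\<^bsub>G\<^esub>}"
  shows "\<exists>x\<in>X. \<forall>a\<in>F. lift_act act a x \<noteq> x"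
proof -
  define t where "t = cls (map (apfst Inl) h)"
  have t: "t \<in> carrier G"
    unfolding t_def by (intro word_class_carrier lists_Inl h)
  have conj: "t [^]\<^bsub>G\<^esub> D \<otimes>\<^bsub>G\<^esub> w [^]\<^bsub>G\<^esub> i \<noteq> w [^]\<^bsub>G\<^esub> j \<otimes>\<^bsub>G\<^esub> t [^]\<^bsub>G\<^esub> D"
    if "D > (0 :: nat)" "i \<noteq> 0" "j \<noteq> 0" for D and i j :: int
    unfolding t_def w_def r_def
    using amalgam_no_conjugate_powers[OF w1(2,3) w2(2,3) lists_Inl[OF w1(1)] lists_Inl[OF h(1)] h(2-) that] .
  have "\<forall>a\<in>F. \<exists>u. u \<in> lists (S \<times> UNIV) \<and> a = cls u"
  proof
    fix a assume "a \<in> F"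
    then have "a \<in> carrier G" using assms(2) by auto
    then show "\<exists>u. u \<in> lists (S \<times> UNIV) \<and> a = cls u" using carrierE by blast
  qed
  then obtain u where u: "\<And>a. a \<in> F \<Longrightarrow> u a \<in> lists (S \<times> UNIV)" "\<And>a. a \<in> F \<Longrightarrow> a = cls (u a)"
    by metis
  \<comment> \<open>For \<open>N\<close> in \<open>B1 a\<close>, \<open>a\<close> fixes the coset of
    \<open>t\<close> to the power \<open>N\<close>; for \<open>N\<close> in \<open>B2\<close> of a
    suffix, the path of that coset runs into \<open>P\<close>.\<close>
  define B1 where "B1 a = {N :: nat. \<exists>k :: int. a \<otimes>\<^bsub>G\<^esub> t [^]\<^bsub>G\<^esub> N = t [^]\<^bsub>G\<^esub> N \<otimes>\<^bsub>G\<^esub> w [^]\<^bsub>G\<^esub> k}" for a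
  define B2 where "B2 a = {N :: nat. \<exists>k :: int. a \<otimes>\<^bsub>G\<^esub> t [^]\<^bsub>G\<^esub> N = w [^]\<^bsub>G\<^esub> k}" for a
  have drop: "cls (drop k (u a)) \<in> carrier G" if "a \<in> F" for a k
    using u(1)[OF that] set_drop_subset[of k "u a"] unfolding lists_eq_set
    by (intro word_class_carrier) (auto simp: lists_eq_set)
  have "finite (B1 a)" if "a \<in> F" for a
    unfolding B1_def using that assms(2) by (intro finite_exceptions(2)[OF t w_carrier conj]) auto
  moreover have "finite (B2 (cls (drop k (u a))))" if "a \<in> F" for a k
    unfolding B2_def using drop[OF that] by (intro finite_exceptions(1)[OF t w_carrier conj])
  ultimately have "finite (\<Union>a\<in>F. B1 a \<union> (\<Union>k\<le>length (u a). B2 (cls (drop k (u a)))))"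
    using assms(1) by blast
  then obtain N where N: "N \<notin> (\<Union>a\<in>F. B1 a \<union> (\<Union>k\<le>length (u a). B2 (cls (drop k (u a)))))"
    using ex_new_if_finite[OF infinite_UNIV_nat] by blast
  define C where "C = translate G (t [^]\<^bsub>G\<^esub> N) P"
  have "t [^]\<^bsub>G\<^esub> N \<in> carrier G" using t by simp
  then obtain v where "v \<in> lists (S \<times> UNIV)" "t [^]\<^bsub>G\<^esub> N = cls v"
    by (rule carrierE)
  then have "Inr C \<in> X" unfolding C_def using Inr_X by simp
  moreover have "lift_act act a (Inr C) \<noteq> Inr C" if a: "a \<in> F" for a
  proof -
    have aG: "a \<in> carrier G" using a assms(2) by blast
    have "translate G (cls (drop k (u a))) C \<noteq> P" for k
    proof
      assume eq: "translate G (cls (drop k (u a))) C = P"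
      \<comment> \<open>The finite union covers only \<open>k\<close> up to the word length; larger
        values give the same empty suffix.\<close>
      define k' where "k' = min k (length (u a))"
      have k': "drop k (u a) = drop k' (u a)" "k' \<le> length (u a)"
        by (auto simp: k'_def min_def)
      have "translate G (cls (drop k' (u a)) \<otimes>\<^bsub>G\<^esub> t [^]\<^bsub>G\<^esub> N) P = translate G \<one>\<^bsub>G\<^esub> P"
        using eq k'(1) t drop[OF a, of k'] by (simp add: C_def translate_mult)
      then have "\<exists>i :: int. cls (drop k' (u a)) \<otimes>\<^bsub>G\<^esub> t [^]\<^bsub>G\<^esub> N = \<one>\<^bsub>G\<^esub> \<otimes>\<^bsub>G\<^esub> w [^]\<^bsub>G\<^esub> i"
        unfolding P_def using t drop[OF a, of k'] w_carrier
        by (intro translate_eqD) auto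
      then have "N \<in> B2 (cls (drop k' (u a)))"
        using w_carrier by (simp add: B2_def)
      then show False using N a k'(2) by blast
    qed
    then have "lift_act act a (Inr C) = Inr (translate G a C)"
      using word_act_Inr_away[OF u(1)[OF a]] u(2)[OF a] lift_act_cls by metis
    moreover have "translate G a C \<noteq> C"
    proof
      assume "translate G a C = C"
      then have "translate G (a \<otimes>\<^bsub>G\<^esub> t [^]\<^bsub>G\<^esub> N) P = translate G (t [^]\<^bsub>G\<^esub> N) P"
        using aG t by (simp add: C_def translate_mult)
      then have "\<exists>i :: int. a \<otimes>\<^bsub>G\<^esub> t [^]\<^bsub>G\<^esub> N = t [^]\<^bsub>G\<^esub> N \<otimes>\<^bsub>G\<^esub> w [^]\<^bsub>G\<^esub> i"
        unfolding P_def using t aG w_carrier by (intro translate_eqD) auto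
      then show False using N a by (auto simp: B1_def)
    qed
    ultimately show ?thesis by simp
  qed
  ultimately show ?thesis by blast
qed

section \<open>Foelner sets far out in the integers\<close>

definition reach :: "(nat + nat) letter list \<Rightarrow> int" where
  "reach u = (\<Sum>l\<leftarrow>u. \<bar>c (fst l)\<bar>)"

lemma word_weight_le_reach: "\<bar>word_weight c u\<bar> \<le> reach u"
  by (induction u) (auto simp: reach_def)

text \<open>All partial weights are bounded by \<open>reach u\<close>, so a start beyond it stays
  positive and never meets 0, the only integer that \<open>swap\<close> moves.\<close>

lemma word_act_Inl_away:
  assumes "k > reach u"
  shows "word_act act u (Inl k) = Inl (k + word_weight c u)"
  using assms
proof (induction u)
  case (Cons l u)
  have "reach (l # u) = \<bar>c (fst l)\<bar> + reach u"
    by (simp add: reach_def)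
  then have "k > reach u" using Cons.prems by simp
  then have IH: "word_act act u (Inl k) = Inl (k + word_weight c u)"
    by (rule Cons.IH)
  have ne: "k + word_weight c u \<noteq> 0" "k + word_weight c (l # u) \<noteq> 0"
    using \<open>k > reach u\<close> Cons.prems word_weight_le_reach[of u] word_weight_le_reach[of "l # u"] by linarith+
  have base: "letter_act base_act l (Inl (k + word_weight c u)) = Inl (k + word_weight c (l # u))"
    using word_base_act_Inl[of "l # u" k] word_base_act_Inl[of u k] by simp
  show ?case
    using IH base ne by (cases "fst l") (simp_all add: letter_act_Inl letter_act_Inr)
qed simp

lemma Folner_on_X: "Folner_on X"
  unfolding Folner_on_def
proof (intro allI impI)
  fix F and \<epsilon> :: real assume F: "finite F" "F \<subseteq> carrier G" and \<epsilon>: "\<epsilon> > 0"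
  have "\<forall>a\<in>F. \<exists>u. a = cls u"
    using F(2) carrierE by (metis subset_eq)
  then obtain u where u: "\<And>a. a \<in> F \<Longrightarrow> a = cls (u a)"
    by metis
  define B where "B = (\<Sum>a\<in>F. reach (u a))"
  have reach_nonneg: "reach v \<ge> 0" for v
    using word_weight_le_reach[of v] by linarith
  have B: "reach (u a) \<le> B" if "a \<in> F" for a
    unfolding B_def using F(1) that reach_nonneg by (intro member_le_sum) auto
  have B0: "B \<ge> 0" unfolding B_def using reach_nonneg by (intro sum_nonneg) auto
  \<comment> \<open>Every shift below is at most \<open>B\<close> in absolute value and produces a
    symmetric difference of at most 4B+2 points; \<open>L\<close> makes this small relative to the
    interval.\<close>
  obtain L :: nat where L: "real_of_int (4 * B + 2) / \<epsilon> < real L"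
    using reals_Archimedean2 by blast
  moreover have "real_of_int (4 * B + 2) / \<epsilon> > 0"
    using B0 \<epsilon> by (intro divide_pos_pos) auto
  ultimately have L0: "L > 0" by (cases L) auto
  define I where "I = {B + 1..B + int L}"
  define A :: "(int + (nat + nat) letter list set set) set" where "A = Inl ` I"
  have card_A: "card A = L"
    by (simp add: A_def I_def card_image)
  have "real (card ((A - lift_act act a ` A) \<union> (lift_act act a ` A - A))) \<le> \<epsilon> * real (card A)"
    if a: "a \<in> F" for a
  proof -
    define t where "t = word_weight c (u a)"
    have t: "\<bar>t\<bar> \<le> B"
      using word_weight_le_reach[of "u a"] B[OF a] by (simp add: t_def)
    have "lift_act act (cls (u a)) (Inl k) = Inl (k + t)" if "k \<in> I" for k
      using that B[OF a] by (simp add: I_def word_act_Inl_away t_def)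
    then have im: "lift_act act a ` A = Inl ` ((\<lambda>k. k + t) ` I)"
      unfolding A_def image_image u[OF a, symmetric] by (intro image_cong) auto
    have "(\<lambda>k. k + t) ` I = {B + 1 + t..B + int L + t}"
      unfolding I_def by simp
    then have im: "lift_act act a ` A = Inl ` {B + 1 + t..B + int L + t}"
      using im by simp
    have "(A - lift_act act a ` A) \<union> (lift_act act a ` A - A)
        = Inl ` ((I - {B + 1 + t..B + int L + t}) \<union> ({B + 1 + t..B + int L + t} - I))"
      unfolding im unfolding A_def by auto
    \<comment> \<open>An interval and its translate by \<open>t\<close> differ only within distance
      \<open>\<bar>t\<bar>\<close> of the two ends, giving two blocks of
      \<open>2 * \<bar>t\<bar> + 1\<close> points.\<close>
    also have "\<dots> \<subseteq> Inl ` ({B + 1 - \<bar>t\<bar>..B + 1 + \<bar>t\<bar>} \<union> {B + int L - \<bar>t\<bar>..B + int L + \<bar>t\<bar>})"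
      unfolding I_def by (intro image_mono) auto
    finally have "card ((A - lift_act act a ` A) \<union> (lift_act act a ` A - A))
        \<le> card (Inl ` ({B + 1 - \<bar>t\<bar>..B + 1 + \<bar>t\<bar>} \<union> {B + int L - \<bar>t\<bar>..B + int L + \<bar>t\<bar>})
            :: (int + (nat + nat) letter list set set) set)"
      by (intro card_mono) auto
    also have "\<dots> \<le> card ({B + 1 - \<bar>t\<bar>..B + 1 + \<bar>t\<bar>} \<union> {B + int L - \<bar>t\<bar>..B + int L + \<bar>t\<bar>})"
      by (intro card_image_le) auto
    also have "\<dots> \<le> card {B + 1 - \<bar>t\<bar>..B + 1 + \<bar>t\<bar>} + card {B + int L - \<bar>t\<bar>..B + int L + \<bar>t\<bar>}"
      by (rule card_Un_le)
    also have "\<dots> = nat (4 * \<bar>t\<bar> + 2)"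
      by simp
    finally have "real (card ((A - lift_act act a ` A) \<union> (lift_act act a ` A - A))) \<le> real_of_int (4 * B + 2)"
      using t by linarith
    also have "\<dots> \<le> \<epsilon> * real L"
      using L \<epsilon> by (simp add: pos_divide_less_eq mult.commute)
    finally show ?thesis by (simp add: card_A)
  qed
  moreover have "finite A" "A \<noteq> {}" "A \<subseteq> X"
    using L0 Inl_X by (auto simp: A_def I_def)
  ultimately show "\<exists>A. finite A \<and> A \<noteq> {} \<and> A \<subseteq> X \<and>
      (\<forall>a\<in>F. real (card ((A - lift_act act a ` A) \<union> (lift_act act a ` A - A))) \<le> \<epsilon> * real (card A))"
    by blast
qed

lemma finite_index_class_A:
  assumes "subgroup H G" "finite (rcosets\<^bsub>G\<^esub> H)"
  shows "class_A (G\<lparr>carrier := H\<rparr>)"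
proof (rule finite_index_subgroup_class_A[of X "Inl 0"])
  show "countable (carrier G)"
    unfolding presented_group_carrier by (intro countable_image countableI_type)
  have "infinite (range (Inl :: int \<Rightarrow> int + (nat + nat) letter list set set))"
    using infinite_UNIV_int by (simp add: finite_image_iff)
  then show "infinite X"
    using Inl_X by (meson finite_subset image_subsetI)
qed (use X_def free_points Folner_on_X assms in blast)+

end

theorem theorem2:
  fixes m n :: nat and w1 w2 :: "nat letter list" and H :: "(nat + nat) letter list set set"
  assumes "m \<ge> 1" and "n \<ge> 1"
    and "set w1 \<subseteq> {..m} \<times> UNIV" and "set w2 \<subseteq> {..n} \<times> UNIV"
    and "w1 \<noteq> []" and "w2 \<noteq> []"
    and "cyclically_reduced w1" and "cyclically_reduced w2"
    and "subgroup H (amalg_group m n w1 w2)"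
    and "finite (rcosets\<^bsub>amalg_group m n w1 w2\<^esub> H)"
  shows "class_A ((amalg_group m n w1 w2)\<lparr>carrier := H\<rparr>)"
proof -
  have lists: "w1 \<in> lists ({..m} \<times> UNIV)" "w2 \<in> lists ({..n} \<times> UNIV)"
    using assms(3,4) by auto
  \<comment> \<open>Rank at least two provides distinct generators 0 and 1 in each factor, for the
    choice of \<open>h\<close> and of the weights.\<close>
  have gens: "0 \<in> {..m}" "1 \<in> {..m}" "0 \<in> {..n}" "1 \<in> {..n}"
    using assms(1,2) by auto
  obtain h where h: "h \<in> lists ({..m} \<times> UNIV)" "cyclically_reduced h" "h \<noteq> []"
    "hd h \<noteq> hd w1" "hd h \<noteq> inv_letter (last w1)" "last h \<noteq> last w1" "last h \<noteq> inv_letter (hd w1)"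
    using exists_noncancelling_word[OF assms(7,5) lists(1) gens(1,2) zero_neq_one] by metis
  obtain c1 za where c1: "word_weight c1 w1 = 0" "za \<in> lists ({..m} \<times> UNIV)" "word_weight c1 za = 1"
    using exists_killing_weight[OF gens(1,2) zero_neq_one] by metis
  obtain c2 zb where c2: "word_weight c2 w2 = 0" "zb \<in> lists ({..n} \<times> UNIV)" "word_weight c2 zb = 1"
    using exists_killing_weight[OF gens(3,4) zero_neq_one] by metis
  \<comment> \<open>The two weights kill \<open>w1\<close> and \<open>w2\<close> respectively, so
    together they define one homomorphism on the amalgam.\<close>
  interpret surgery m n w1 w2 h za zb "case_sum c1 c2"
    using assms lists h c1 c2 by unfold_locales auto
  have "amalg_group m n w1 w2 = G"
    by (simp add: amalg_group_def S_def r_def)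
  then show ?thesis
    using finite_index_class_A assms(9,10) by simp
qed

end
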